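(* Let $d\ge 1$ be an integer and let $\mathbb{P}$ be any complete product probability measure on $\mathbb{R}^d$. For all Borel subsets $A,B\subset\mathbb{R}^d$, the set $A\,\square\,B$ is $\mathbb{P}$-measurable and $$\mathbb{P}(A\,\square\,B)\le \mathbb{P}(A)\,\mathbb{P}(B).$$ Moreover, for every integer $r\ge 2$ and all Borel subsets $A_1,\dots,A_r\subset\mathbb{R}^d$, the set $\square_{i=1}^r A_i$ is $\mathbb{P}$-measurable and $$\mathbb{P}\Big(\square_{i=1}^r A_i\Big)\le\prod_{i=1}^r\mathbb{P}(A_i).$$
   Context: Write $[d]=\{1,\dots,d\}$ and $S=\mathbb{R}$. For $\omega\in S^d$ and $K\subset[d]$, let $\mathrm{Cyl}(K,\omega)=\{\overline\omega\in S^d:\overline\omega_i=\omega_i \text{ for all } i\in K\}$. For $A\subset S^d$ let $[A]_K=\{\omega\in S^d:\mathrm{Cyl}(K,\omega)\subset A\}$. The BKR operator is defined, for $A,B\subset S^d$, by $A\,\square\,B=\bigcup_{K\subset[d]}[A]_K\cap[B]_{[d]\setminus K}$; equivalently $A\,\square\,B=\bigcup[A]_J\cap[B]_K$, the union being over all pairs of disjoint $J,K\subset[d]$. The simultaneous $r$-fold BKR operator is defined, for $A_1,\dots,A_r\subset S^d$, by $\square_{i=1}^rA_i=\bigcup[A_1]_{J_1}\cap\cdots\cap[A_r]_{J_r}$, the union being over all $r$-tuples of pairwise disjoint (possibly empty) subsets $J_1,\dots,J_r$ of $[d]$. A complete product probability measure on $\mathbb{R}^d$ is the completion of a product $\mu_1\times\cdots\times\mu_d$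 of (arbitrary, not necessarily equal) Borel probability measures $\mu_i$ on $\mathbb{R}$; "$\mathbb{P}$-measurable" means belonging to the completed sigma-algebra. *)

theory Defs
  imports "HOL-Probability.Probability"
begin

text \<open>
  Points of \<open>\<real>\<^sup>d\<close> are functions \<open>nat \<Rightarrow> real\<close> that are \<open>undefined\<close> outside the index set
  \<open>{1..d}\<close>; this is the carrier of both the library's product topology and its product measure.
\<close>

definition Rd :: "nat \<Rightarrow> (nat \<Rightarrow> real) set" where
  "Rd d = (\<Pi>\<^sub>E i\<in>{1..d}. UNIV)"

definition borel_sets :: "nat \<Rightarrow> (nat \<Rightarrow> real) set set" where
  "borel_sets d = sigma_sets (Rd d) {U. openin (product_topology (\<lambda>_. euclideanreal) {1..d}) U}"

definition complete_product_prob :: "nat \<Rightarrow> (nat \<Rightarrow> real) measure \<Rightarrow> bool" where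
  "complete_product_prob d P \<longleftrightarrow>
     (\<exists>\<mu> :: nat \<Rightarrow> real measure.
        (\<forall>i\<in>{1..d}. prob_space (\<mu> i) \<and> sets (\<mu> i) = sets borel) \<and>
        P = completion (Pi\<^sub>M {1..d} \<mu>))"

definition Cyl :: "nat \<Rightarrow> nat set \<Rightarrow> (nat \<Rightarrow> real) \<Rightarrow> (nat \<Rightarrow> real) set" where
  "Cyl d K \<omega> = {\<omega>' \<in> Rd d. \<forall>i\<in>K. \<omega>' i = \<omega> i}"

text \<open>\<open>cyl_core d A K\<close> is the set written $[A]_K$.\<close>

definition cyl_core :: "nat \<Rightarrow> (nat \<Rightarrow> real) set \<Rightarrow> nat set \<Rightarrow> (nat \<Rightarrow> real) set" where
  "cyl_core d A K = {\<omega> \<in> Rd d. Cyl d K \<omega> \<subseteq> A}"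

definition BKR :: "nat \<Rightarrow> (nat \<Rightarrow> real) set \<Rightarrow> (nat \<Rightarrow> real) set \<Rightarrow> (nat \<Rightarrow> real) set" where
  "BKR d A B = (\<Union>K\<in>Pow {1..d}. cyl_core d A K \<inter> cyl_core d B ({1..d} - K))"

definition BKR_family :: "nat \<Rightarrow> nat \<Rightarrow> (nat \<Rightarrow> (nat \<Rightarrow> real) set) \<Rightarrow> (nat \<Rightarrow> real) set" where
  "BKR_family d r A =
     (\<Union>J\<in>{J \<in> {1..r} \<rightarrow> Pow {1..d}. disjoint_family_on J {1..r}}.
        \<Inter>i\<in>{1..r}. cyl_core d (A i) (J i))"

lemma cyl_core_mono: "J \<subseteq> K \<Longrightarrow> cyl_core d A J \<subseteq> cyl_core d A K"
  by (auto simp: cyl_core_def Cyl_def)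

lemma BKR_eq_disjoint_pairs:
  "BKR d A B =
     (\<Union>(J, K)\<in>{(J, K). J \<subseteq> {1..d} \<and> K \<subseteq> {1..d} \<and> J \<inter> K = {}}. cyl_core d A J \<inter> cyl_core d B K)"
proof (intro equalityI subsetI)
  fix \<omega> assume "\<omega> \<in> BKR d A B"
  then obtain K where K: "K \<subseteq> {1..d}" "\<omega> \<in> cyl_core d A K \<inter> cyl_core d B ({1..d} - K)"
    by (auto simp: BKR_def)
  then show "\<omega> \<in> (\<Union>(J, K)\<in>{(J, K). J \<subseteq> {1..d} \<and> K \<subseteq> {1..d} \<and> J \<inter> K = {}}.
      cyl_core d A J \<inter> cyl_core d B K)"
    by (intro UN_I[of "(K, {1..d} - K)"]) auto
next
  fix \<omega> assume "\<omega> \<in> (\<Union>(J, K)\<in>{(J, K). J \<subseteq> {1..d} \<and> K \<subseteq> {1..d} \<and> J \<inter> K = {}}.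
      cyl_core d A J \<inter> cyl_core d B K)"
  then obtain J K where JK: "J \<subseteq> {1..d}" "K \<subseteq> {1..d}" "J \<inter> K = {}"
      "\<omega> \<in> cyl_core d A J" "\<omega> \<in> cyl_core d B K"
    by auto
  moreover have "K \<subseteq> {1..d} - J"
    using JK by auto
  ultimately have "\<omega> \<in> cyl_core d B ({1..d} - J)"
    using cyl_core_mono by blast
  then show "\<omega> \<in> BKR d A B"
    using JK by (auto simp: BKR_def)
qed

lemma borel_sets_eq_PiM: "borel_sets d = sets (Pi\<^sub>M {1..d} (\<lambda>_. borel))"
proof -
  let ?T = "product_topology (\<lambda>_. euclideanreal) {1..d}"
  let ?P = "Pi\<^sub>M {1..d} (\<lambda>_. borel :: real measure)"
  define N where "N = sigma (Rd d) {U. openin ?T U}"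
  have top: "topspace ?T = Rd d"
    by (simp add: Rd_def)
  have sub: "{U. openin ?T U} \<subseteq> Pow (Rd d)"
    using openin_subset[of ?T] top by auto
  have sN: "space N = Rd d" "sets N = borel_sets d"
    using sub by (simp_all add: N_def borel_sets_def)
  have sP: "space ?P = Rd d"
    by (simp add: space_PiM Rd_def)
  have "sets ?P \<subseteq> sets N"
  proof -
    have comp: "(\<lambda>\<omega>. \<omega> i) \<in> N \<rightarrow>\<^sub>M borel" if i: "i \<in> {1..d}" for i
    proof (rule borel_measurableI)
      fix S :: "real set" assume S: "open S"
      have "openin ?T {\<omega> \<in> topspace ?T. \<omega> i \<in> S}"
        using i S
        by (intro openin_continuous_map_preimage[OF continuous_map_product_projection]) auto
      then show "(\<lambda>\<omega>. \<omega> i) -` S \<inter> space N \<in> sets N"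
        unfolding sN top by (auto simp: borel_sets_def vimage_def Int_def conj_commute)
    qed
    have id: "(\<lambda>\<omega>. \<omega>) \<in> N \<rightarrow>\<^sub>M ?P"
    proof (rule measurable_PiM_single')
      show "(\<lambda>\<omega>. \<omega>) \<in> space N \<rightarrow> (\<Pi>\<^sub>E i\<in>{1..d}. space (borel :: real measure))"
        by (simp add: sN Rd_def)
    qed (use comp in auto)
    show ?thesis
    proof
      fix X assume X: "X \<in> sets ?P"
      have "(\<lambda>\<omega>. \<omega>) -` X \<inter> space N \<in> sets N"
        by (rule measurable_sets[OF id X])
      moreover have "X \<subseteq> space N"
        using sets.sets_into_space[OF X] unfolding sN sP .
      ultimately show "X \<in> sets N"
        by (simp add: Int_absorb2)
    qed
  qed
  moreover have "U \<in> sets ?P" if U: "openin ?T U" for U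
  proof -
    obtain \<B> :: "real set set" where \<B>: "countable \<B>" "topological_basis \<B>"
      using ex_countable_basis by blast
    define \<F> where "\<F> = {Pi\<^sub>E {1..d} X |X. X \<in> {1..d} \<rightarrow>\<^sub>E \<B> \<and> Pi\<^sub>E {1..d} X \<subseteq> U}"
    have cF: "countable \<F>"
    proof (rule countable_subset)
      show "\<F> \<subseteq> Pi\<^sub>E {1..d} ` ({1..d} \<rightarrow>\<^sub>E \<B>)"
        by (auto simp: \<F>_def)
      show "countable (Pi\<^sub>E {1..d} ` ({1..d} \<rightarrow>\<^sub>E \<B>))"
        using \<B> by (intro countable_image countable_PiE) auto
    qed
    have FP: "\<F> \<subseteq> sets ?P"
    proof
      fix Y assume "Y \<in> \<F>"
      then obtain X where X: "X \<in> {1..d} \<rightarrow>\<^sub>E \<B>" "Y = Pi\<^sub>E {1..d} X"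
        unfolding \<F>_def by blast
      have "X i \<in> sets borel" if "i \<in> {1..d}" for i
        using PiE_mem[OF X(1) that] topological_basis_open[OF \<B>(2)] by (blast intro: borel_open)
      then show "Y \<in> sets ?P"
        unfolding X(2) by (intro sets_PiM_I_finite) simp_all
    qed
    have "U = \<Union>\<F>"
    proof (intro equalityI subsetI)
      fix x assume x: "x \<in> U"
      have "\<forall>x\<in>U. \<exists>V. finite {i \<in> {1..d}. V i \<noteq> topspace euclideanreal} \<and>
          (\<forall>i\<in>{1..d}. openin euclideanreal (V i)) \<and> x \<in> Pi\<^sub>E {1..d} V \<and> Pi\<^sub>E {1..d} V \<subseteq> U"
        using U unfolding openin_product_topology_alt .
      from bspec[OF this x] obtain V
        where V': "\<forall>i\<in>{1..d}. open (V i)" and V: "x \<in> Pi\<^sub>E {1..d} V" "Pi\<^sub>E {1..d} V \<subseteq> U"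
        unfolding open_openin[symmetric] by (elim exE conjE)
      have "\<exists>b\<in>\<B>. x i \<in> b \<and> b \<subseteq> V i" if "i \<in> {1..d}" for i
        by (rule topological_basisE[OF \<B>(2) bspec[OF V' that] PiE_mem[OF V(1) that]]) blast
      then obtain b where b: "\<And>i. i \<in> {1..d} \<Longrightarrow> b i \<in> \<B> \<and> x i \<in> b i \<and> b i \<subseteq> V i"
        by metis
      define X where "X = restrict b {1..d}"
      have xX: "x \<in> Pi\<^sub>E {1..d} X"
        using b V(1) by (auto simp: X_def PiE_iff)
      have "Pi\<^sub>E {1..d} X \<subseteq> Pi\<^sub>E {1..d} V"
        using b by (intro PiE_mono) (simp add: X_def)
      then have XU: "Pi\<^sub>E {1..d} X \<subseteq> U"
        using V(2) by (rule order_trans)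
      have XB: "X \<in> {1..d} \<rightarrow>\<^sub>E \<B>"
        using b by (auto simp: X_def)
      have "Pi\<^sub>E {1..d} X \<in> \<F>"
        unfolding \<F>_def by (intro CollectI exI[of _ X] conjI refl XB XU)
      then show "x \<in> \<Union>\<F>"
        using xX by (rule UnionI)
    next
      fix x assume "x \<in> \<Union>\<F>"
      then show "x \<in> U"
        unfolding \<F>_def by (elim UnionE CollectE exE conjE) (simp only: subset_iff)
    qed
    then show ?thesis
      using cF FP by (metis sets.countable_Union)
  qed
  then have "{U. openin ?T U} \<subseteq> sets ?P"
    by blast
  then have "sets N \<subseteq> sets ?P"
    unfolding sN borel_sets_def sP[symmetric] by (rule sets.sigma_sets_subset)
  ultimately show ?thesis
    using sN by auto
qed

end

theory Submission
  imports Defs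
begin

text \<open>
  The event \<open>[A]\<^sub>K\<close> is the complement of a cylinder over a projection of a Borel set. Such projections are
  analytic, hence measurable by Choquet's capacitability theorem; this gives measurability of the box
  operators and lets one replace each \<open>[A]\<^sub>K\<close> by a Borel cylinder over \<open>K\<close> up to a null set. Measurable
  cylinders are transported to the unit cube by quantile functions and approximated there by dyadic ones,
  which reduces the inequality to Reimer's theorem for the uniform measure on a Boolean cube. The latter is
  proved by linear algebra: \<open>|A \<box> B|\<close> is at most the number of points of \<open>A\<close> whose flip lies in \<open>B\<close>, for every
  set of flipped coordinates, and summing over these sets gives the inequality. The \<open>r\<close>-fold inequality
  follows by induction, splitting off the last event.
\<close>

section \<open>Reimer's inequality on finite cubes\<close>

text \<open>Removing a null set from an event \<open>A\<close> can empty
  \<open>cyl_core d A K\<close> for every proper subset \<open>K\<close> of the coordinates, so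
  boxes are not stable under approximation of the events. The inequality is therefore proved for
  families of cylinders \<open>F K\<close>, with their union in the role of the event: each member
  is approximated separately, and the Borel replacement of \<open>cyl_core d A K\<close> is taken
  inside it, so that the union stays inside \<open>A\<close>. The same generality carries the
  induction on the number of events. A box of Borel events need not be Borel, so a bound for two
  Borel events could not be iterated, whereas disjoint occurrence of several events within
  \<open>K\<close>, as \<open>K\<close> varies, is again a family of cylinders. In the finite case,
  integer coefficients allow two arguments to meet: positive definiteness over the integers, and
  independence of the butterflies modulo 2.\<close>

text \<open>Gaussian elimination with pivot \<open>c p y\<close>; cross-multiplying instead of
  dividing stays within the integers, where parity makes sense.\<close>

lemma nontrivial_int_solution:
  fixes c :: "'a \<Rightarrow> 'b \<Rightarrow> int"
  assumes "finite Y" "finite X" "card Y < card X"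
  shows "\<exists>a. (\<exists>x\<in>X. a x \<noteq> 0) \<and> (\<forall>y\<in>Y. (\<Sum>x\<in>X. a x * c x y) = 0)"
  using assms
proof (induction Y arbitrary: X c rule: finite_induct)
  case empty
  then obtain x where "x \<in> X" by fastforce
  then show ?case by (intro exI[of _ "\<lambda>_. 1"]) auto
next
  case (insert y Y)
  show ?case
  proof (cases "\<forall>x\<in>X. c x y = 0")
    case True
    from insert.prems insert.hyps have "card Y < card X" by simp
    from insert.IH[OF insert.prems(1) this, of c] True show ?thesis
      by auto
  next
    case False
    then obtain p where p: "p \<in> X" "c p y \<noteq> 0" by blast
    define c' where "c' x z = c p y * c x z - c x y * c p z" for x z
    have "card Y < card (X - {p})"
      using insert.prems insert.hyps p by simp
    from insert.IH[OF _ this, of c'] insert.prems obtain a where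
      a: "\<exists>x\<in>X - {p}. a x \<noteq> 0" "\<forall>z\<in>Y. (\<Sum>x\<in>X - {p}. a x * c' x z) = 0"
      by auto
    \<comment> \<open>Back substitution: equation \<open>y\<close> determines the coefficient of
      \<open>p\<close>, and scaling the others by the pivot clears the denominator.\<close>
    define b where "b x = (if x = p then - (\<Sum>x\<in>X - {p}. a x * c x y) else c p y * a x)" for x
    have sum_b: "(\<Sum>x\<in>X. b x * c x z) =
        c p y * (\<Sum>x\<in>X - {p}. a x * c x z) - (\<Sum>x\<in>X - {p}. a x * c x y) * c p z" for z
    proof -
      have "(\<Sum>x\<in>X. b x * c x z) = b p * c p z + (\<Sum>x\<in>X - {p}. b x * c x z)"
        using insert.prems p by (simp add: sum.remove)
      also have "(\<Sum>x\<in>X - {p}. b x * c x z) = c p y * (\<Sum>x\<in>X - {p}. a x * c x z)"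
        unfolding sum_distrib_left by (intro sum.cong) (auto simp: b_def)
      finally show ?thesis by (simp add: b_def)
    qed
    have "(\<Sum>x\<in>X. b x * c x z) = 0" if "z \<in> insert y Y" for z
    proof (cases "z = y")
      case True
      then show ?thesis unfolding sum_b by simp
    next
      case False
      then have "(\<Sum>x\<in>X - {p}. a x * c' x z) = 0" using that a by simp
      then show ?thesis
        unfolding sum_b c'_def
        by (simp add: algebra_simps sum_subtractf sum_distrib_left)
    qed
    moreover have "\<exists>x\<in>X. b x \<noteq> 0"
      using a(1) p by (auto simp: b_def)
    ultimately show ?thesis by blast
  qed
qed

text \<open>A nonzero solution with only even coefficients can be halved, which lowers the sum of
  absolute values, so halving stops at a solution with an odd coefficient.\<close>

lemma primitive_int_solution:
  fixes c :: "'a \<Rightarrow> 'b \<Rightarrow> int"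
  assumes "finite Y" "finite X" "card Y < card X"
  shows "\<exists>a. (\<exists>x\<in>X. odd (a x)) \<and> (\<forall>y\<in>Y. (\<Sum>x\<in>X. a x * c x y) = 0)"
proof -
  have "\<exists>a. (\<exists>x\<in>X. odd (a x)) \<and> (\<forall>y\<in>Y. (\<Sum>x\<in>X. a x * c x y) = 0)"
    if "\<exists>x\<in>X. a x \<noteq> 0" "\<forall>y\<in>Y. (\<Sum>x\<in>X. a x * c x y) = 0" for a
    using that
  proof (induction "\<Sum>x\<in>X. nat \<bar>a x\<bar>" arbitrary: a rule: less_induct)
    case less
    show ?case
    proof (cases "\<exists>x\<in>X. odd (a x)")
      case True
      then show ?thesis using less.prems by blast
    next
      case False
      define b where "b x = a x div 2" for x
      have ab: "a x = 2 * b x" if "x \<in> X" for x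
        using False that by (auto simp: b_def)
      have "(\<Sum>x\<in>X. nat \<bar>b x\<bar>) < (\<Sum>x\<in>X. nat \<bar>a x\<bar>)"
      proof (rule sum_strict_mono_ex1[OF assms(2)])
        show "\<forall>x\<in>X. nat \<bar>b x\<bar> \<le> nat \<bar>a x\<bar>" using ab by auto
        from less.prems obtain x where "x \<in> X" "a x \<noteq> 0" by blast
        then show "\<exists>x\<in>X. nat \<bar>b x\<bar> < nat \<bar>a x\<bar>"
          using ab by (intro bexI[of _ x]) auto
      qed
      moreover have "\<exists>x\<in>X. b x \<noteq> 0" using less.prems(1) ab by auto
      moreover have "(\<Sum>x\<in>X. b x * c x y) = 0" if "y \<in> Y" for y
      proof -
        have "(\<Sum>x\<in>X. a x * c x y) = 2 * (\<Sum>x\<in>X. b x * c x y)"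
          unfolding sum_distrib_left by (intro sum.cong) (auto simp: ab)
        then show ?thesis using less.prems(2) that by simp
      qed
      ultimately show ?thesis using less.hyps[of b] by blast
    qed
  qed
  then show ?thesis using nontrivial_int_solution[OF assms, of c] by blast
qed

section \<open>Tensor product kernels on the Boolean cube\<close>

lemma sum_Pow_insert:
  fixes f :: "'a set \<Rightarrow> 'b :: comm_monoid_add"
  assumes "finite I" "i \<notin> I"
  shows "sum f (Pow (insert i I)) = (\<Sum>y\<in>Pow I. f y) + (\<Sum>y\<in>Pow I. f (insert i y))"
proof -
  have "inj_on (insert i) (Pow I)"
    using assms(2) by (auto simp: inj_on_def)
  then show ?thesis
    using assms by (subst Pow_insert, subst sum.union_disjoint) (auto simp: sum.reindex)
qed

text \<open>Distributivity: a subset \<open>y\<close> picks one of the two terms in every factor.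
  This reduces applying a tensor product kernel to one-coordinate computations.\<close>

lemma sum_Pow_prod:
  fixes h :: "'a \<Rightarrow> bool \<Rightarrow> 'b :: comm_semiring_1"
  assumes "finite I"
  shows "(\<Sum>y\<in>Pow I. \<Prod>i\<in>I. h i (i \<in> y)) = (\<Prod>i\<in>I. h i True + h i False)"
  using assms
proof (induction I rule: finite_induct)
  case (insert i I)
  have "(\<Prod>j\<in>insert i I. h j (j \<in> y)) = h i False * (\<Prod>j\<in>I. h j (j \<in> y))"
       "(\<Prod>j\<in>insert i I. h j (j \<in> insert i y)) = h i True * (\<Prod>j\<in>I. h j (j \<in> y))"
    if "y \<in> Pow I" for y
  proof -
    have "i \<notin> y" using insert.hyps that by blast
    moreover have "(\<Prod>j\<in>I. h j (j \<in> insert i y)) = (\<Prod>j\<in>I. h j (j \<in> y))"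
      using insert.hyps by (intro prod.cong) (auto intro: arg_cong)
    ultimately show "(\<Prod>j\<in>insert i I. h j (j \<in> y)) = h i False * (\<Prod>j\<in>I. h j (j \<in> y))"
       "(\<Prod>j\<in>insert i I. h j (j \<in> insert i y)) = h i True * (\<Prod>j\<in>I. h j (j \<in> y))"
      using insert.hyps by simp_all
  qed
  then have "(\<Sum>y\<in>Pow (insert i I). \<Prod>j\<in>insert i I. h j (j \<in> y)) =
      (\<Sum>y\<in>Pow I. h i False * (\<Prod>j\<in>I. h j (j \<in> y))) +
      (\<Sum>y\<in>Pow I. h i True * (\<Prod>j\<in>I. h j (j \<in> y)))"
    unfolding sum_Pow_insert[OF insert.hyps] by (intro arg_cong2[of _ _ _ _ "(+)"] sum.cong refl)
  also have "\<dots> = (\<Prod>j\<in>insert i I. h j True + h j False)"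
    using insert.hyps by (simp add: sum_distrib_left[symmetric] insert.IH distrib_right add.commute)
  finally show ?case .
qed simp

text \<open>
  Points of the Boolean cube over \<open>I\<close> are the subsets of \<open>I\<close>. The kernel is the tensor power of the
  positive definite matrix with rows \<open>(2, -1)\<close> and \<open>(-1, 2)\<close> over the coordinates in \<open>D\<close>, and of the
  identity matrix over the others. The rows \<open>(1, 2)\<close> and \<open>(2, 1)\<close> used in \<open>butterfly\<close> outside \<open>S\<close> are
  mapped by that matrix to \<open>(0, 3)\<close> and \<open>(3, 0)\<close>, which is why the image of a butterfly lives on points
  that disagree with \<open>x\<close> on \<open>D - S\<close>.
\<close>

definition flip_kernel :: "'a set \<Rightarrow> 'a set \<Rightarrow> 'a set \<Rightarrow> 'a set \<Rightarrow> int" where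
  "flip_kernel D I y z =
     (\<Prod>i\<in>I. if i \<in> D then (if i \<in> y \<longleftrightarrow> i \<in> z then 2 else - 1) else of_bool (i \<in> y \<longleftrightarrow> i \<in> z))"

definition butterfly :: "'a set \<Rightarrow> 'a set \<Rightarrow> 'a set \<Rightarrow> 'a set \<Rightarrow> 'a set \<Rightarrow> int" where
  "butterfly D I S x y =
     (\<Prod>i\<in>I. if i \<in> x \<longleftrightarrow> i \<in> y then 1 else if i \<in> D - S then 2 else 0)"

lemma flip_kernel_insert:
  fixes D :: "'a set"
  assumes "finite I" "i \<notin> I" "y \<subseteq> I" "z \<subseteq> I"
  defines "a \<equiv> (if i \<in> D then 2 else 1)" and "b \<equiv> (if i \<in> D then - 1 else 0)"
  shows "flip_kernel D (insert i I) y z = a * flip_kernel D I y z"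
    and "flip_kernel D (insert i I) (insert i y) (insert i z) = a * flip_kernel D I y z"
    and "flip_kernel D (insert i I) (insert i y) z = b * flip_kernel D I y z"
    and "flip_kernel D (insert i I) y (insert i z) = b * flip_kernel D I y z"
proof -
  have *: "(\<Prod>j\<in>I. if j \<in> D then (if j \<in> y' \<longleftrightarrow> j \<in> z' then 2 else - 1) else of_bool (j \<in> y' \<longleftrightarrow> j \<in> z'))
     = flip_kernel D I y z" if "y' = y \<or> y' = insert i y" "z' = z \<or> z' = insert i z" for y' z'
    unfolding flip_kernel_def using that assms(2) by (intro prod.cong) auto
  have ni: "i \<notin> y" "i \<notin> z" using assms by auto
  have split: "flip_kernel D (insert i I) y' z' =
     (if i \<in> D then (if i \<in> y' \<longleftrightarrow> i \<in> z' then 2 else - 1) else of_bool (i \<in> y' \<longleftrightarrow> i \<in> z')) *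
     flip_kernel D I y z" if "y' = y \<or> y' = insert i y" "z' = z \<or> z' = insert i z" for y' z'
    unfolding *[OF that, symmetric] unfolding flip_kernel_def using assms(1,2) by simp
  show "flip_kernel D (insert i I) y z = a * flip_kernel D I y z"
    "flip_kernel D (insert i I) (insert i y) (insert i z) = a * flip_kernel D I y z"
    "flip_kernel D (insert i I) (insert i y) z = b * flip_kernel D I y z"
    "flip_kernel D (insert i I) y (insert i z) = b * flip_kernel D I y z"
    using ni by (auto simp: split a_def b_def)
qed

text \<open>Splitting off a coordinate turns a vector into a pair \<open>v\<close>, \<open>w\<close>
  on the smaller cube. In a coordinate of \<open>D\<close>, the identity 2a^2 - 2ab + 2b^2 = a^2 +
  b^2 + (a - b)^2 writes the form as the sum of its values at \<open>v\<close>, \<open>w\<close> and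
  \<open>v - w\<close>; elsewhere only the first two occur. Both sums inherit definiteness.\<close>

lemma flip_kernel_pos_def:
  fixes v :: "'a set \<Rightarrow> int" and D :: "'a set"
  assumes "finite I"
  defines "Q \<equiv> \<lambda>I v. \<Sum>y\<in>Pow I. \<Sum>z\<in>Pow I. v y * v z * flip_kernel D I y z"
  shows "Q I v \<ge> 0 \<and> (Q I v = 0 \<longrightarrow> (\<forall>y\<in>Pow I. v y = 0))"
  using assms(1)
proof (induction I arbitrary: v rule: finite_induct)
  case empty
  show ?case by (simp add: Q_def flip_kernel_def)
next
  case (insert i I)
  define w where "w y = v (insert i y)" for y
  define B where "B f g = (\<Sum>y\<in>Pow I. \<Sum>z\<in>Pow I. f y * g z * flip_kernel D I y z)" for f g
  have sym: "flip_kernel D I y z = flip_kernel D I z y" for y z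
    unfolding flip_kernel_def by (intro prod.cong) auto
  have B_sym: "B w v = B v w"
    unfolding B_def by (subst sum.swap) (intro sum.cong refl, simp add: sym mult.commute)
  have B_Q: "B f f = Q I f" for f by (simp add: B_def Q_def)
  let ?a = "if i \<in> D then 2 else 1 :: int" and ?b = "if i \<in> D then - 1 else 0 :: int"
  have "Q (insert i I) v = ?a * B v v + ?b * B v w + (?b * B w v + ?a * B w w)"
  proof -
    have inner: "(\<Sum>z\<in>Pow I. v y * v z * flip_kernel D (insert i I) y z) +
          (\<Sum>z\<in>Pow I. v y * v (insert i z) * flip_kernel D (insert i I) y (insert i z)) =
        ?a * (\<Sum>z\<in>Pow I. v y * v z * flip_kernel D I y z) +
        ?b * (\<Sum>z\<in>Pow I. v y * w z * flip_kernel D I y z)"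
      "(\<Sum>z\<in>Pow I. v (insert i y) * v z * flip_kernel D (insert i I) (insert i y) z) +
          (\<Sum>z\<in>Pow I. v (insert i y) * v (insert i z) * flip_kernel D (insert i I) (insert i y) (insert i z)) =
        ?b * (\<Sum>z\<in>Pow I. w y * v z * flip_kernel D I y z) +
        ?a * (\<Sum>z\<in>Pow I. w y * w z * flip_kernel D I y z)" if y: "y \<in> Pow I" for y
      unfolding sum_distrib_left w_def using y insert.hyps
      by (intro arg_cong2[of _ _ _ _ "(+)"] sum.cong refl; simp add: flip_kernel_insert)+
    have "Q (insert i I) v =
      (\<Sum>y\<in>Pow I. ?a * (\<Sum>z\<in>Pow I. v y * v z * flip_kernel D I y z) +
        ?b * (\<Sum>z\<in>Pow I. v y * w z * flip_kernel D I y z)) +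
      (\<Sum>y\<in>Pow I. ?b * (\<Sum>z\<in>Pow I. w y * v z * flip_kernel D I y z) +
        ?a * (\<Sum>z\<in>Pow I. w y * w z * flip_kernel D I y z))"
      unfolding Q_def sum_Pow_insert[OF insert.hyps]
      by (intro arg_cong2[of _ _ _ _ "(+)"] sum.cong refl inner)
    then show ?thesis
      unfolding B_def sum.distrib sum_distrib_left[symmetric] .
  qed
  then have eq: "Q (insert i I) v = ?a * Q I v + ?a * Q I w + 2 * ?b * B v w"
    by (simp add: B_Q B_sym)
  have "Q I (\<lambda>y. v y - w y) = B v v - B v w - B w v + B w w"
    unfolding Q_def B_def by (simp add: algebra_simps sum_subtractf sum.distrib)
  then have diff: "Q I (\<lambda>y. v y - w y) = Q I v + Q I w - 2 * B v w"
    by (simp add: B_Q B_sym)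
  have "Q (insert i I) v = Q I v + Q I w + (if i \<in> D then Q I (\<lambda>y. v y - w y) else 0)"
    unfolding eq diff by simp
  moreover have nn: "Q I v \<ge> 0" "Q I w \<ge> 0" "Q I (\<lambda>y. v y - w y) \<ge> 0"
    using insert.IH by blast+
  ultimately have "Q (insert i I) v \<ge> Q I v + Q I w"
    by (cases "i \<in> D") simp_all
  moreover have "\<forall>y\<in>Pow (insert i I). v y = 0" if "Q I v = 0" "Q I w = 0"
    using that insert.IH[of v] insert.IH[of w] unfolding w_def Pow_insert by blast
  ultimately show ?case using nn by linarith
qed

text \<open>The zeros are what counts: a nonzero value forces \<open>z\<close> to differ from
  \<open>x\<close> on \<open>D - S\<close> and to agree with it off \<open>D\<close>, so flipping
  \<open>z\<close> on \<open>D\<close> gives a point that agrees with \<open>x\<close> off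
  \<open>S\<close>, all within \<open>I\<close>.\<close>

lemma flip_kernel_butterfly:
  assumes "finite I"
  shows "(\<Sum>y\<in>Pow I. flip_kernel D I z y * butterfly D I S x y) =
    (\<Prod>i\<in>I. if i \<in> x \<longleftrightarrow> i \<in> z then (if i \<in> D - S then 0 else if i \<in> D then 2 else 1)
             else (if i \<in> D - S then 3 else if i \<in> D then - 1 else 0))"
proof -
  define h where "h i b = (if i \<in> D then (if i \<in> z \<longleftrightarrow> b then 2 else - 1) else of_bool (i \<in> z \<longleftrightarrow> b)) *
     (if i \<in> x \<longleftrightarrow> b then 1 else if i \<in> D - S then 2 else 0 :: int)" for i b
  have "(\<Sum>y\<in>Pow I. flip_kernel D I z y * butterfly D I S x y) = (\<Sum>y\<in>Pow I. \<Prod>i\<in>I. h i (i \<in> y))"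
    by (simp add: flip_kernel_def butterfly_def prod.distrib[symmetric] h_def)
  also have "\<dots> = (\<Prod>i\<in>I. h i True + h i False)"
    by (rule sum_Pow_prod[OF assms])
  also have "\<dots> = (\<Prod>i\<in>I. if i \<in> x \<longleftrightarrow> i \<in> z then (if i \<in> D - S then 0 else if i \<in> D then 2 else 1)
             else (if i \<in> D - S then 3 else if i \<in> D then - 1 else 0))"
    by (intro prod.cong) (auto simp: h_def)
  finally show ?thesis .
qed

text \<open>Of the possible factors 0, 1 and 2 only 1 is odd, so modulo 2 butterflies are point
  masses.\<close>

lemma butterfly_mod_2:
  assumes "finite I" "x \<subseteq> I" "y \<subseteq> I"
  shows "odd (butterfly D I S x y) \<longleftrightarrow> x = y"
proof
  assume "odd (butterfly D I S x y)"
  then have "\<forall>i\<in>I. odd (if i \<in> x \<longleftrightarrow> i \<in> y then 1 else if i \<in> D - S then 2 else 0 :: int)"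
    unfolding butterfly_def using assms(1) by (simp only: even_prod_iff) blast
  then have "\<forall>i\<in>I. i \<in> x \<longleftrightarrow> i \<in> y" by (auto split: if_splits)
  then show "x = y" using assms by auto
qed (simp add: butterfly_def)

text \<open>
  A combination \<open>v\<close> of the butterflies of \<open>X\<close> is supported on \<open>A\<close>, and its image under the kernel on the
  flip of \<open>B\<close>. If \<open>X\<close> had more elements than the intersection of the two, some combination with
  integer coefficients that are not all even would vanish on that intersection; then \<open>v\<close> is orthogonal to its
  image, so \<open>v = 0\<close> by positive definiteness. But modulo 2 the values of \<open>v\<close> on \<open>X\<close> are its coefficients.
\<close>

lemma card_box_le_card_flip:
  assumes I: "finite I" and X: "X \<subseteq> Pow I"
    and box: "\<And>x. x \<in> X \<Longrightarrow> \<exists>S. (\<forall>y\<in>Pow I. y \<inter> S = x \<inter> S \<longrightarrow> y \<in> A) \<and>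
               (\<forall>y\<in>Pow I. y \<inter> (I - S) = x \<inter> (I - S) \<longrightarrow> y \<in> B)"
    and D: "D \<subseteq> I"
  shows "card X \<le> card {y\<in>Pow I. y \<in> A \<and> sym_diff y D \<in> B}" (is "_ \<le> card ?Z")
proof (rule ccontr)
  assume "\<not> card X \<le> card ?Z"
  have "\<forall>x\<in>X. \<exists>S. (\<forall>y\<in>Pow I. y \<inter> S = x \<inter> S \<longrightarrow> y \<in> A) \<and>
               (\<forall>y\<in>Pow I. y \<inter> (I - S) = x \<inter> (I - S) \<longrightarrow> y \<in> B)"
    using box by (intro ballI)
  from bchoice[OF this] obtain S where
    S: "\<forall>x\<in>X. (\<forall>y\<in>Pow I. y \<inter> S x = x \<inter> S x \<longrightarrow> y \<in> A) \<and>
               (\<forall>y\<in>Pow I. y \<inter> (I - S x) = x \<inter> (I - S x) \<longrightarrow> y \<in> B)" by (elim exE)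
  have SA: "y \<in> A" if "x \<in> X" "y \<subseteq> I" "y \<inter> S x = x \<inter> S x" for x y
    using bspec[OF conjunct1[OF bspec[OF S]], of x y] that by simp
  have SB: "y \<in> B" if "x \<in> X" "y \<subseteq> I" "y \<inter> (I - S x) = x \<inter> (I - S x)" for x y
    using bspec[OF conjunct2[OF bspec[OF S]], of x y] that by simp
  have finX: "finite X" using finite_subset[OF X] I by simp
  define u where "u x = butterfly D I (S x) x" for x
  obtain a where a: "\<exists>x\<in>X. odd (a x)" "\<forall>y\<in>?Z. (\<Sum>x\<in>X. a x * u x y) = 0"
  proof -
    have "finite ?Z" "card ?Z < card X"
      using I \<open>\<not> card X \<le> card ?Z\<close> by simp_all
    from primitive_int_solution[OF this(1) finX this(2), of u] that show thesis by blast
  qed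
  define v where "v y = (\<Sum>x\<in>X. a x * u x y)" for y
  have v_A: "y \<in> A" if y: "y \<subseteq> I" "v y \<noteq> 0" for y
  proof -
    obtain x where x: "x \<in> X" "u x y \<noteq> 0"
      using sum.not_neutral_contains_not_neutral[OF y(2)[unfolded v_def]] by auto
    have "i \<in> y \<longleftrightarrow> i \<in> x" if i: "i \<in> I" "i \<in> S x" for i
    proof (rule ccontr)
      assume "\<not> ?thesis"
      then have "butterfly D I (S x) x y = 0"
        unfolding butterfly_def using i by (intro prod_zero[OF I] bexI[of _ i]) auto
      then show False using x(2) unfolding u_def by simp
    qed
    moreover have "x \<subseteq> I" using x X by blast
    ultimately have "y \<inter> S x = x \<inter> S x"
      using that(1) by (intro set_eqI) (simp only: Int_iff, blast)
    then show ?thesis by (rule SA[OF x(1) that(1)])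
  qed
  have Mv_B: "sym_diff z D \<in> B"
    if z: "z \<subseteq> I" "(\<Sum>y\<in>Pow I. flip_kernel D I z y * v y) \<noteq> 0" for z
  proof -
    have "(\<Sum>y\<in>Pow I. flip_kernel D I z y * v y) =
        (\<Sum>x\<in>X. a x * (\<Sum>y\<in>Pow I. flip_kernel D I z y * u x y))"
      unfolding v_def sum_distrib_left by (subst sum.swap) (simp add: mult_ac)
    then have "(\<Sum>x\<in>X. a x * (\<Sum>y\<in>Pow I. flip_kernel D I z y * u x y)) \<noteq> 0"
      using z(2) by simp
    from sum.not_neutral_contains_not_neutral[OF this]
    obtain x where x: "x \<in> X" "(\<Sum>y\<in>Pow I. flip_kernel D I z y * u x y) \<noteq> 0"
      by auto
    have "i \<in> sym_diff z D \<longleftrightarrow> i \<in> x" if i: "i \<in> I" "i \<notin> S x" for i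
    proof (rule ccontr)
      assume "\<not> ?thesis"
      then have "(\<Sum>y\<in>Pow I. flip_kernel D I z y * u x y) = 0"
        unfolding u_def flip_kernel_butterfly[OF I]
        using i by (intro prod_zero[OF I] bexI[of _ i]) auto
      then show False using x(2) by simp
    qed
    then have "sym_diff z D \<inter> (I - S x) = x \<inter> (I - S x)"
      by (intro set_eqI) (simp only: Int_iff Diff_iff, blast)
    moreover have "sym_diff z D \<subseteq> I" using z(1) D by blast
    ultimately show ?thesis by (intro SB[OF x(1)])
  qed
  \<comment> \<open>Off \<open>?Z\<close> one of the two factors vanishes by \<open>v_A\<close> or
    \<open>Mv_B\<close>; on \<open>?Z\<close> the first vanishes by the choice of
    \<open>a\<close>.\<close>
  have "v y * (\<Sum>z\<in>Pow I. flip_kernel D I y z * v z) = 0" if "y \<in> Pow I" for y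
  proof (rule ccontr)
    assume "\<not> ?thesis"
    then have "y \<in> ?Z" using v_A[of y] Mv_B[of y] that by auto
    then have "v y = 0" using a(2) unfolding v_def by blast
    with \<open>\<not> ?thesis\<close> show False by simp
  qed
  then have "(\<Sum>y\<in>Pow I. \<Sum>z\<in>Pow I. v y * v z * flip_kernel D I y z) = 0"
    by (intro sum.neutral) (auto simp: sum_distrib_left mult_ac)
  then have v0: "\<forall>y\<in>Pow I. v y = 0"
    using flip_kernel_pos_def[OF I, of v D] by simp
  from a(1) obtain p where p: "p \<in> X" "odd (a p)" by blast
  have "odd (v p)"
  proof -
    have "v p = a p * u p p + (\<Sum>x\<in>X - {p}. a x * u x p)"
      unfolding v_def using finX p by (simp add: sum.remove)
    moreover have "even (\<Sum>x\<in>X - {p}. a x * u x p)"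
    proof (rule dvd_sum)
      fix x assume x: "x \<in> X - {p}"
      then have "x \<subseteq> I" "p \<subseteq> I" "x \<noteq> p" using X p by blast+
      then have "even (u x p)" unfolding u_def using butterfly_mod_2[OF I] by blast
      then show "even (a x * u x p)" by simp
    qed
    moreover have "odd (u p p)"
      using butterfly_mod_2[OF I, of p p] X p unfolding u_def by blast
    ultimately show ?thesis using p by simp
  qed
  with v0 p X show False by auto
qed

text \<open>
  A pair \<open>(y, z) \<in> A \<times> B\<close> is determined by \<open>y\<close> and the set \<open>D\<close> of coordinates where the two points differ,
  so \<open>card A * card B\<close> is the sum over \<open>D\<close> of the quantities bounded below in the preceding lemma.
\<close>

theorem reimer_cube:
  assumes I: "finite I" and X: "X \<subseteq> Pow I" and AB: "A \<subseteq> Pow I" "B \<subseteq> Pow I"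
    and box: "\<And>x. x \<in> X \<Longrightarrow> \<exists>S. (\<forall>y\<in>Pow I. y \<inter> S = x \<inter> S \<longrightarrow> y \<in> A) \<and>
               (\<forall>y\<in>Pow I. y \<inter> (I - S) = x \<inter> (I - S) \<longrightarrow> y \<in> B)"
  shows "card X * 2 ^ card I \<le> card A * card B"
proof -
  have "card X * 2 ^ card I = (\<Sum>D\<in>Pow I. card X)"
    using I by (simp add: card_Pow)
  also have "\<dots> \<le> (\<Sum>D\<in>Pow I. card {y\<in>Pow I. y \<in> A \<and> sym_diff y D \<in> B})"
    using card_box_le_card_flip[OF I X box] by (intro sum_mono) auto
  also have "\<dots> = card (SIGMA D:Pow I. {y\<in>Pow I. y \<in> A \<and> sym_diff y D \<in> B})"
    using I by (subst card_SigmaI) auto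
  also have "\<dots> = card (A \<times> B)"
  proof (rule bij_betw_same_card)
    have inv: "sym_diff y (sym_diff y z) = z" "sym_diff (sym_diff y z) y = z" for y z :: "'a set"
      by blast+
    have "sym_diff y z \<in> Pow I" if "y \<in> Pow I" "z \<in> Pow I" for y z
      using that by blast
    then show "bij_betw (\<lambda>(D, y). (y, sym_diff y D))
        (SIGMA D:Pow I. {y\<in>Pow I. y \<in> A \<and> sym_diff y D \<in> B}) (A \<times> B)"
      using AB by (intro bij_betw_byWitness[where f' = "\<lambda>(y, z). (sym_diff y z, y)"])
        (auto simp only: inv case_prod_conv mem_Sigma_iff mem_Collect_eq image_subset_iff split_paired_all subset_iff)
  qed
  also have "\<dots> = card A * card B" by (simp add: card_cartesian_product)
  finally show ?thesis .
qed

section \<open>From the Boolean cube to grids of side \<open>2 ^ k\<close>\<close>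

text \<open>A coordinate with \<open>2 ^ k\<close> values amounts to \<open>k\<close> bits, under
  any bijection \<open>e\<close>. A witness \<open>S\<close> becomes the set of all bits of its
  coordinates, so the bits of one coordinate are never separated.\<close>

corollary reimer_grid:
  fixes I :: "'i set" and k :: nat
  defines "\<Omega> \<equiv> I \<rightarrow>\<^sub>E {..<2 ^ k :: nat}"
  assumes I: "finite I" and sub: "X \<subseteq> \<Omega>" "A \<subseteq> \<Omega>" "B \<subseteq> \<Omega>"
    and box: "\<And>x. x \<in> X \<Longrightarrow> \<exists>S. (\<forall>y\<in>\<Omega>. (\<forall>i\<in>S. y i = x i) \<longrightarrow> y \<in> A) \<and>
               (\<forall>y\<in>\<Omega>. (\<forall>i\<in>I - S. y i = x i) \<longrightarrow> y \<in> B)"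
  shows "card X * card \<Omega> \<le> card A * card B"
proof -
  obtain e :: "nat \<Rightarrow> nat set" where e: "bij_betw e {..<2 ^ k} (Pow {..<k})"
    using finite_same_card_bij[of "{..<2 ^ k :: nat}" "Pow {..<k}"] by (auto simp: card_Pow)
  define \<Phi> where "\<Phi> \<omega> = {(i, j). i \<in> I \<and> j \<in> e (\<omega> i)}" for \<omega> :: "'i \<Rightarrow> nat"
  define J where "J = I \<times> {..<k}"
  have e_sub: "e (\<omega> i) \<subseteq> {..<k}" if "\<omega> \<in> \<Omega>" "i \<in> I" for \<omega> i
    using that bij_betw_apply[OF e] by (auto simp: \<Omega>_def PiE_iff)
  have \<Phi>_slice: "{j. (i, j) \<in> \<Phi> \<omega>} = e (\<omega> i)" if "i \<in> I" for \<omega> i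
    using that by (auto simp: \<Phi>_def)
  have e_eqD: "x i = y i" if "x \<in> \<Omega>" "y \<in> \<Omega>" "i \<in> I" "e (x i) = e (y i)" for x y i
    using that bij_betw_imp_inj_on[OF e] by (auto simp: \<Omega>_def PiE_iff inj_on_def)
  have \<Phi>: "bij_betw \<Phi> \<Omega> (Pow J)"
    unfolding bij_betw_def
  proof
    show "inj_on \<Phi> \<Omega>"
    proof (rule inj_onI)
      fix x y assume xy: "x \<in> \<Omega>" "y \<in> \<Omega>" "\<Phi> x = \<Phi> y"
      then have "x i = y i" if "i \<in> I" for i
        using \<Phi>_slice[OF that] e_eqD that by metis
      then show "x = y" using xy unfolding \<Omega>_def by (intro PiE_ext[of x]) auto
    qed
    show "\<Phi> ` \<Omega> = Pow J"
    proof
      show "\<Phi> ` \<Omega> \<subseteq> Pow J" using e_sub by (auto simp: \<Phi>_def J_def)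
      show "Pow J \<subseteq> \<Phi> ` \<Omega>"
      proof
        fix y assume y: "y \<in> Pow J"
        define \<omega> where "\<omega> = (\<lambda>i\<in>I. inv_into {..<2 ^ k} e {j. (i, j) \<in> y})"
        have sl: "{j. (i, j) \<in> y} \<in> e ` {..<2 ^ k}" for i
          using y bij_betw_imp_surj_on[OF e] by (auto simp: J_def)
        have "\<omega> \<in> \<Omega>"
          using inv_into_into[OF sl] by (auto simp: \<Omega>_def \<omega>_def)
        moreover have "\<Phi> \<omega> = y"
          using y f_inv_into_f[OF sl] by (auto simp: \<Phi>_def \<omega>_def J_def)
        ultimately show "y \<in> \<Phi> ` \<Omega>" by blast
      qed
    qed
  qed
  have card_\<Phi>: "card (\<Phi> ` Z) = card Z" if "Z \<subseteq> \<Omega>" for Z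
    using that bij_betw_imp_inj_on[OF \<Phi>] by (intro card_image) (rule inj_on_subset)
  have \<Phi>_sub: "\<Phi> ` Z \<subseteq> Pow J" if "Z \<subseteq> \<Omega>" for Z
    using that bij_betw_imp_surj_on[OF \<Phi>] by blast
  have transfer: "\<Phi> y \<in> \<Phi> ` Z"
    if Z: "\<forall>y\<in>\<Omega>. (\<forall>i\<in>S. y i = x i) \<longrightarrow> y \<in> Z" and xy: "x \<in> \<Omega>" "y \<in> \<Omega>"
      and agree: "\<Phi> y \<inter> (S \<times> UNIV) = \<Phi> x \<inter> (S \<times> UNIV)" for x y S Z
  proof -
    have "y i = x i" if "i \<in> S" for i
    proof (cases "i \<in> I")
      case True
      have "{j. (i, j) \<in> \<Phi> y} = {j. (i, j) \<in> \<Phi> x}" using agree that by blast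
      then show ?thesis using True xy e_eqD by (simp add: \<Phi>_slice)
    next
      case False
      then show ?thesis using xy by (auto simp: \<Omega>_def PiE_iff extensional_def)
    qed
    then show ?thesis using Z xy by blast
  qed
  have "card (\<Phi> ` X) * 2 ^ card J \<le> card (\<Phi> ` A) * card (\<Phi> ` B)"
  proof (rule reimer_cube)
    fix x' assume "x' \<in> \<Phi> ` X"
    then obtain x where x: "x \<in> X" "x' = \<Phi> x" by blast
    obtain S where S: "\<forall>y\<in>\<Omega>. (\<forall>i\<in>S. y i = x i) \<longrightarrow> y \<in> A"
        "\<forall>y\<in>\<Omega>. (\<forall>i\<in>I - S. y i = x i) \<longrightarrow> y \<in> B"
      using box[OF x(1)] by (elim exE conjE)
    have xO: "x \<in> \<Omega>" using x sub by blast
    show "\<exists>S. (\<forall>y\<in>Pow J. y \<inter> S = x' \<inter> S \<longrightarrow> y \<in> \<Phi> ` A) \<and>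
              (\<forall>y\<in>Pow J. y \<inter> (J - S) = x' \<inter> (J - S) \<longrightarrow> y \<in> \<Phi> ` B)"
    proof (intro exI[of _ "S \<times> UNIV"] conjI ballI impI)
      fix y' assume y': "y' \<in> Pow J"
      then obtain y where y: "y' = \<Phi> y" "y \<in> \<Omega>" using bij_betw_imp_surj_on[OF \<Phi>] by blast
      show "y' \<in> \<Phi> ` A" if "y' \<inter> (S \<times> UNIV) = x' \<inter> (S \<times> UNIV)"
        unfolding y(1) by (rule transfer[OF S(1) xO y(2)]) (use that x y in simp)
      show "y' \<in> \<Phi> ` B" if eq: "y' \<inter> (J - S \<times> UNIV) = x' \<inter> (J - S \<times> UNIV)"
      proof -
        have "\<Phi> x \<subseteq> J" using \<Phi>_sub[of "{x}"] xO by simp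
        then have "\<Phi> y \<inter> ((I - S) \<times> UNIV) = \<Phi> x \<inter> ((I - S) \<times> UNIV)"
          using eq y y' x unfolding J_def by blast
        then show ?thesis
          unfolding y(1) by (rule transfer[OF S(2) xO y(2)])
      qed
    qed
  qed (use I sub \<Phi>_sub in \<open>auto simp: J_def\<close>)
  moreover have "2 ^ card J = card \<Omega>"
    using I by (simp add: J_def \<Omega>_def card_cartesian_product card_PiE power_mult mult.commute[of _ k])
  ultimately show ?thesis using sub by (simp add: card_\<Phi>)
qed

section \<open>Measurability of projections\<close>

text \<open>The function \<open>f\<close> is a code for membership of \<open>x\<close>: countable
  set operations become operations on codes, and bounding the entries of \<open>f\<close> leaves a
  compact set of codes.\<close>

definition analytic :: "'a::topological_space set \<Rightarrow> bool" where
  "analytic E \<longleftrightarrow> (\<exists>C :: ('a \<times> (nat \<Rightarrow> nat)) set. closed C \<and> E = {x. \<exists>f. (x, f) \<in> C})"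

lemma analyticI:
  fixes C :: "('a::topological_space \<times> (nat \<Rightarrow> nat)) set"
  shows "closed C \<Longrightarrow> (\<And>x. x \<in> E \<longleftrightarrow> (\<exists>f. (x, f) \<in> C)) \<Longrightarrow> analytic E"
  unfolding analytic_def by blast

lemma closed_imp_analytic: "closed E \<Longrightarrow> analytic E"
  by (rule analyticI[of "E \<times> UNIV"]) (auto intro: closed_Times)

text \<open>A code for the union announces in entry 0 which set is meant and continues with a code
  for that set.\<close>

lemma analytic_UN:
  fixes E :: "nat \<Rightarrow> 'a::topological_space set"
  assumes "\<And>n. analytic (E n)"
  shows "analytic (\<Union>n. E n)"
proof -
  from assms obtain C :: "nat \<Rightarrow> ('a \<times> (nat \<Rightarrow> nat)) set" where
    C: "\<And>n. closed (C n)" "\<And>n. E n = {x. \<exists>f. (x, f) \<in> C n}"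
    unfolding analytic_def by metis
  let ?tl = "\<lambda>p :: 'a \<times> (nat \<Rightarrow> nat). (fst p, \<lambda>k. snd p (Suc k))"
  \<comment> \<open>One implication for each \<open>n\<close>, since an intersection of closed sets
    is closed while an infinite union need not be.\<close>
  define D where "D = (\<Inter>n. {p. snd p 0 \<in> - {n}} \<union> ?tl -` C n)"
  have "continuous_on UNIV ?tl"
    by (intro continuous_intros continuous_on_coordinatewise_then_product)
       (rule continuous_on_compose2[OF continuous_on_product_coordinates], auto intro: continuous_intros)
  then have 1: "closed (?tl -` C n)" for n
    by (intro closed_vimage C)
  have "continuous_on UNIV (\<lambda>p :: 'a \<times> (nat \<Rightarrow> nat). snd p 0)"
    by (rule continuous_on_compose2[OF continuous_on_product_coordinates], auto intro: continuous_intros)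
  moreover have "closed S" for S :: "nat set"
    by (simp add: closed_def Topological_Spaces.open_discrete)
  ultimately have 2: "closed {p :: 'a \<times> (nat \<Rightarrow> nat). snd p 0 \<in> - {n}}" for n
    unfolding vimage_def[symmetric] by (intro closed_vimage)
  show ?thesis
  proof (rule analyticI)
    show "closed D" unfolding D_def using 1 2 by (intro closed_INT ballI closed_Un)
    show "x \<in> (\<Union>n. E n) \<longleftrightarrow> (\<exists>f. (x, f) \<in> D)" for x
    proof
      assume "x \<in> (\<Union>n. E n)"
      then obtain n f where "(x, f) \<in> C n" by (auto simp: C)
      then have "(x, case_nat n f) \<in> D" by (auto simp: D_def)
      then show "\<exists>f. (x, f) \<in> D" by (rule exI[where x = "case_nat n f"])
    next
      assume "\<exists>f. (x, f) \<in> D"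
      then obtain f where "(x, f) \<in> D" ..
      then have "(x, \<lambda>k. f (Suc k)) \<in> C (f 0)" by (auto simp: D_def)
      then show "x \<in> (\<Union>n. E n)" by (auto simp: C)
    qed
  qed
qed

text \<open>A code for the intersection interleaves codes for all the sets, the one for
  \<open>E n\<close> being read at the positions \<open>prod_encode (n, k)\<close>.\<close>

lemma analytic_INT:
  fixes E :: "nat \<Rightarrow> 'a::topological_space set"
  assumes "\<And>n. analytic (E n)"
  shows "analytic (\<Inter>n. E n)"
proof -
  from assms obtain C :: "nat \<Rightarrow> ('a \<times> (nat \<Rightarrow> nat)) set" where
    C: "\<And>n. closed (C n)" "\<And>n. E n = {x. \<exists>f. (x, f) \<in> C n}"
    unfolding analytic_def by metis
  let ?row = "\<lambda>n (p :: 'a \<times> (nat \<Rightarrow> nat)). (fst p, \<lambda>k. snd p (prod_encode (n, k)))"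
  have "continuous_on UNIV (?row n)" for n
    by (intro continuous_intros continuous_on_coordinatewise_then_product)
       (rule continuous_on_compose2[OF continuous_on_product_coordinates], auto intro: continuous_intros)
  then have 1: "closed (?row n -` C n)" for n
    by (intro closed_vimage C)
  show ?thesis
  proof (rule analyticI)
    show "closed (\<Inter>n. ?row n -` C n)" using 1 by (intro closed_INT ballI)
    show "x \<in> (\<Inter>n. E n) \<longleftrightarrow> (\<exists>f. (x, f) \<in> (\<Inter>n. ?row n -` C n))" for x
    proof
      assume "x \<in> (\<Inter>n. E n)"
      then have "\<forall>n. \<exists>f. (x, f) \<in> C n" by (auto simp: C)
      then obtain g where "\<And>n. (x, g n) \<in> C n" by metis
      then have "(x, \<lambda>j. g (fst (prod_decode j)) (snd (prod_decode j))) \<in> (\<Inter>n. ?row n -` C n)"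
        by auto
      then show "\<exists>f. (x, f) \<in> (\<Inter>n. ?row n -` C n)"
        by (rule exI[where x = "\<lambda>j. g (fst (prod_decode j)) (snd (prod_decode j))"])
    qed (auto simp: C)
  qed
qed

lemma closed_PiE_UNIV: "closed (I \<rightarrow>\<^sub>E (UNIV :: 'b::t1_space set))"
proof -
  have "I \<rightarrow>\<^sub>E (UNIV :: 'b set) = (\<Inter>i\<in>- I. (\<lambda>x. x i) -` {undefined})"
    by (auto simp: PiE_iff extensional_def)
  also have "closed \<dots>"
    by (intro closed_INT ballI closed_vimage) (auto intro: continuous_on_product_coordinates)
  finally show ?thesis .
qed

text \<open>Complements of analytic sets need not be analytic, so the sigma-algebra used consists of
  the sets that are analytic together with their complement. All coordinates are measurable for it,
  hence it contains the product sigma-algebra.\<close>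

lemma analytic_sets_PiM:
  assumes "A \<in> sets (Pi\<^sub>M I (\<lambda>_. borel :: real measure))"
  shows "analytic A"
proof -
  let ?\<Omega> = "I \<rightarrow>\<^sub>E (UNIV :: real set)"
  let ?P = "Pi\<^sub>M I (\<lambda>_. borel :: real measure)"
  define \<A> where "\<A> = {A. A \<subseteq> ?\<Omega> \<and> analytic A \<and> analytic (?\<Omega> - A)}"
  have \<A>: "sigma_algebra ?\<Omega> \<A>"
    unfolding sigma_algebra_iff2
  proof (intro conjI ballI allI impI)
    show "{} \<in> \<A>"
      by (auto simp: \<A>_def intro!: closed_imp_analytic closed_PiE_UNIV)
    show "?\<Omega> - s \<in> \<A>" if "s \<in> \<A>" for s
      using that by (auto simp: \<A>_def double_diff)
    show "(\<Union>i. F i) \<in> \<A>" if F: "range F \<subseteq> \<A>" for F :: "nat \<Rightarrow> _"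
    proof -
      have "?\<Omega> - (\<Union>i. F i) = (\<Inter>i. ?\<Omega> - F i)" by auto
      moreover have "analytic (\<Union>i. F i)"
        using F by (intro analytic_UN) (auto simp: \<A>_def)
      moreover have "analytic (\<Inter>i. ?\<Omega> - F i)"
        using F by (intro analytic_INT) (auto simp: \<A>_def)
      ultimately show ?thesis
        using F by (auto simp: \<A>_def image_subset_iff simp del: INT_simps)
    qed
  qed (auto simp: \<A>_def)
  define N where "N = sigma ?\<Omega> \<A>"
  have sN: "space N = ?\<Omega>" "sets N = \<A>"
    unfolding N_def using \<A> by (auto simp: sigma_algebra.sets_measure_of_eq \<A>_def space_measure_of_conv)
  have comp: "(\<lambda>x. x i) \<in> borel_measurable N" if "i \<in> I" for i
  proof (rule borel_measurableI_le)
    fix a :: real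
    have cont: "continuous_on UNIV (\<lambda>x :: 'a \<Rightarrow> real. x i)"
      by (rule continuous_on_product_coordinates)
    have "closed {x :: 'a \<Rightarrow> real. x i \<le> a}" "\<And>b. closed {x :: 'a \<Rightarrow> real. b \<le> x i}"
      using closed_Collect_le[OF cont continuous_on_const] closed_Collect_le[OF continuous_on_const cont]
      by auto
    then have 1: "analytic (?\<Omega> \<inter> {x. x i \<le> a})" "\<And>b. analytic (?\<Omega> \<inter> {x. b \<le> x i})"
      by (intro closed_imp_analytic closed_Int closed_PiE_UNIV; simp)+
    \<comment> \<open>An open half-space is a countable union of closed ones; this makes the
      complement of a closed half-space analytic.\<close>
    have gt: "x i > a \<longleftrightarrow> (\<exists>n::nat. a + 1 / (Suc n) \<le> x i)" for x :: "'a \<Rightarrow> real"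
    proof
      assume "a < x i"
      then obtain n :: nat where "inverse (of_nat (Suc n)) < x i - a"
        using reals_Archimedean[of "x i - a"] by auto
      then show "\<exists>n::nat. a + 1 / (Suc n) \<le> x i"
        by (intro exI[of _ n]) (simp add: inverse_eq_divide)
    next
      assume "\<exists>n::nat. a + 1 / (Suc n) \<le> x i"
      then obtain n :: nat where "a + 1 / (Suc n) \<le> x i" ..
      moreover have "1 / real (Suc n) > 0" by simp
      ultimately show "a < x i" by linarith
    qed
    have "?\<Omega> - ?\<Omega> \<inter> {x. x i \<le> a} = ?\<Omega> \<inter> {x. x i > a}"
      by auto
    also have "\<dots> = (\<Union>n::nat. ?\<Omega> \<inter> {x. a + 1 / (Suc n) \<le> x i})"
      unfolding gt by blast
    finally have "?\<Omega> - ?\<Omega> \<inter> {x. x i \<le> a} = (\<Union>n::nat. ?\<Omega> \<inter> {x. a + 1 / (Suc n) \<le> x i})" .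
    with 1 have "?\<Omega> \<inter> {x. x i \<le> a} \<in> \<A>"
      by (auto simp only: \<A>_def intro!: analytic_UN)
    then show "{x \<in> space N. x i \<le> a} \<in> sets N"
      by (simp add: sN Int_def)
  qed
  have "(\<lambda>x. x) \<in> N \<rightarrow>\<^sub>M ?P"
    by (rule measurable_PiM_single') (use comp in \<open>auto simp: sN\<close>)
  from measurable_sets[OF this assms] have "A \<inter> ?\<Omega> \<in> \<A>"
    by (simp add: sN Int_def vimage_def)
  moreover have "A \<subseteq> ?\<Omega>"
    using sets.sets_into_space[OF assms] by (simp add: space_PiM)
  ultimately show ?thesis by (simp add: \<A>_def Int_absorb2)
qed


section \<open>Capacitability and the measurability of projections\<close>

lemma compact_PiE_UNIV:
  fixes S :: "'i \<Rightarrow> 'b::topological_space set"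
  assumes "\<And>i. compact (S i)"
  shows "compact (Pi\<^sub>E UNIV S)"
  using assms compactin_PiE[of "\<lambda>_. euclidean" UNIV S]
  by (simp add: euclidean_product_topology)

lemma tendsto_fun_iff:
  fixes f :: "'c \<Rightarrow> 'i \<Rightarrow> 'b::topological_space"
  shows "(f \<longlongrightarrow> l) F \<longleftrightarrow> (\<forall>i. ((\<lambda>c. f c i) \<longlongrightarrow> l i) F)"
  using limitin_componentwise[of "\<lambda>_::'i. euclidean :: 'b topology" UNIV f l F]
  by (simp add: euclidean_product_topology)

text \<open>Inner approximations within \<open>1 / Suc n\<close> of the outer measure have a union
  of full outer measure, so its gap to the measurable hull \<open>W\<close> is null.\<close>

lemma null_gap_if_inner_approx:
  assumes "finite_measure M" and E: "E \<subseteq> space M"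
    and inner: "\<And>c. c < outer_measure_of M E \<Longrightarrow> \<exists>Z\<in>sets M. Z \<subseteq> E \<and> c \<le> emeasure M Z"
  shows "\<exists>Z\<in>sets M. \<exists>N\<in>null_sets M. Z \<subseteq> E \<and> E \<subseteq> Z \<union> N"
proof -
  interpret finite_measure M by fact
  obtain W where W: "W \<in> sets M" "E \<subseteq> W" "outer_measure_of M E = emeasure M W"
    using outer_measure_of_attain[OF E] by blast
  show ?thesis
  proof (cases "measure M W = 0")
    \<comment> \<open>No \<open>c\<close> lies strictly below outer measure 0, so
      \<open>inner\<close> gives nothing here and \<open>W\<close> itself serves as the null
      set.\<close>
    case True
    then have "W \<in> null_sets M" using W by (simp add: null_sets_def emeasure_eq_measure)
    then show ?thesis using W by (intro bexI[of _ "{}"] bexI[of _ W]) auto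
  next
    case False
    then have pos: "measure M W > 0" by (simp add: zero_less_measure_iff)
    have "\<exists>Z\<in>sets M. Z \<subseteq> E \<and> measure M W - 1 / Suc n \<le> measure M Z" for n
    proof -
      have "ennreal (measure M W - 1 / Suc n) < outer_measure_of M E"
        unfolding W emeasure_eq_measure using pos by (intro ennreal_lessI) auto
      from inner[OF this] show ?thesis
        by (auto simp: emeasure_eq_measure ennreal_le_iff)
    qed
    then obtain Z where Z: "\<And>n. Z n \<in> sets M" "\<And>n. Z n \<subseteq> E"
        "\<And>n. measure M W - 1 / Suc n \<le> measure M (Z n)"
      by metis
    define U where "U = (\<Union>n. Z n)"
    have U: "U \<in> sets M" "U \<subseteq> E" using Z by (auto simp: U_def)
    have "measure M W - 1 / Suc n \<le> measure M U" for n
      using Z(3)[of n] finite_measure_mono[of "Z n" U] U Z(1) by (force simp: U_def)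
    moreover have "(\<lambda>n. measure M W - 1 / Suc n) \<longlonglongrightarrow> measure M W - 0"
      by (intro tendsto_intros LIMSEQ_Suc[OF lim_1_over_n])
    ultimately have "measure M W \<le> measure M U"
      by (intro LIMSEQ_le_const2[of _ "measure M W"]) auto
    then have "measure M (W - U) = 0"
      using U W measure_nonneg[of M "W - U"] by (subst finite_measure_Diff) (auto simp: finite_measure_Diff)
    then have "W - U \<in> null_sets M"
      using U W by (simp add: null_sets_def emeasure_eq_measure)
    then show ?thesis using U W by (intro bexI[of _ U] bexI[of _ "W - U"]) auto
  qed
qed

text \<open>
  Choquet's capacitability argument. The bounds \<open>b i\<close> on the coordinates of the witness are chosen one at a
  time so that the outer measure stays above \<open>c\<close>; compactness of the set of bounded witnesses shows that
  the intersection of the closures is still contained in the image.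
\<close>

lemma compact_analytic_image_inner_approx:
  fixes C :: "('a::{first_countable_topology, t2_space} \<times> (nat \<Rightarrow> nat)) set"
    and h :: "'a \<Rightarrow> 'b::metric_space"
  assumes M: "finite_measure M" "\<And>Z. closed Z \<Longrightarrow> Z \<inter> space M \<in> sets M"
    and C: "closed C" "C \<subseteq> B \<times> UNIV" "compact B"
    and h: "continuous_on B h" "h ` B \<subseteq> space M"
    and c: "c < outer_measure_of M (h ` {x. \<exists>f. (x, f) \<in> C})"
  shows "\<exists>Z\<in>sets M. Z \<subseteq> h ` {x. \<exists>f. (x, f) \<in> C} \<and> c \<le> emeasure M Z"
proof -
  interpret finite_measure M by fact
  define T where "T k m = h ` {x. \<exists>f. (\<forall>i<k. f i \<le> m i) \<and> (x, f) \<in> C}" for k :: nat and m :: "nat \<Rightarrow> nat"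
  have T_space: "T k m \<subseteq> space M" for k m
    using C(2) h(2) by (fastforce simp: T_def)
  have "\<exists>s. \<forall>k. c < outer_measure_of M (T k (s k)) \<and> (\<forall>i<k. s (Suc k) i = s k i)"
  proof (rule dependent_nat_choice)
    show "\<exists>m. c < outer_measure_of M (T 0 m)" using c by (simp add: T_def)
  next
    fix m k assume less: "c < outer_measure_of M (T k m)"
    have "T k m = (\<Union>n. T (Suc k) (m(k := n)))"
    proof
      show "T k m \<subseteq> (\<Union>n. T (Suc k) (m(k := n)))"
      proof
        fix y assume "y \<in> T k m"
        then obtain x f where "y = h x" "\<forall>i<k. f i \<le> m i" "(x, f) \<in> C" by (auto simp: T_def)
        then have "y \<in> T (Suc k) (m(k := f k))"
          by (auto simp: T_def less_Suc_eq intro!: imageI exI[of _ f])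
        then show "y \<in> (\<Union>n. T (Suc k) (m(k := n)))" by blast
      qed
      show "(\<Union>n. T (Suc k) (m(k := n))) \<subseteq> T k m"
        by (auto simp: T_def less_Suc_eq)
    qed
    moreover have "incseq (\<lambda>n. T (Suc k) (m(k := n)))"
    proof (intro incseq_SucI)
      fix n
      have "f i \<le> (m(k := Suc n)) i" if "f i \<le> (m(k := n)) i" for i and f :: "nat \<Rightarrow> nat"
        using that by (auto split: if_splits)
      then show "T (Suc k) (m(k := n)) \<le> T (Suc k) (m(k := Suc n))"
        unfolding T_def by (intro image_mono Collect_mono impI) (elim ex_forward conj_forward all_forward imp_forward)
    qed
    \<comment> \<open>Outer measure is continuous along increasing sequences of arbitrary subsets of
      the space, measurable or not.\<close>
    ultimately have "outer_measure_of M (T k m) = (SUP n. outer_measure_of M (T (Suc k) (m(k := n))))"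
      using SUP_outer_measure_of_incseq[of "\<lambda>n. T (Suc k) (m(k := n))", OF T_space] by simp
    with less obtain n where "c < outer_measure_of M (T (Suc k) (m(k := n)))"
      by (auto simp: less_SUP_iff)
    then show "\<exists>m'. c < outer_measure_of M (T (Suc k) m') \<and> (\<forall>i<k. m' i = m i)"
      by (intro exI[of _ "m(k := n)"]) auto
  qed
  then obtain s where s: "\<And>k. c < outer_measure_of M (T k (s k))"
      "\<And>k i. i < k \<Longrightarrow> s (Suc k) i = s k i" by blast
  define b where "b i = s (Suc i) i" for i
  have sb: "s k i = b i" if "i < k" for k i
    using that
  proof (induction k)
    case (Suc k)
    then show ?case using s(2)[of i k] by (cases "i = k") (auto simp: b_def)
  qed simp
  have T_b: "T k (s k) = T k b" for k
    by (auto simp: T_def sb)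
  define Z where "Z k = closure (T k b) \<inter> space M" for k
  have Z_sets: "Z k \<in> sets M" for k by (simp add: Z_def M)
  have "decseq Z"
    unfolding decseq_Suc_iff Z_def T_def
    by (intro allI Int_mono closure_mono image_mono order_refl) (auto simp: less_Suc_eq)
  have "c \<le> emeasure M (Z k)" for k
  proof -
    have "c \<le> outer_measure_of M (T k b)" using s(1)[of k] T_b by simp
    also have "\<dots> \<le> outer_measure_of M (Z k)"
      using closure_subset[of "T k b"] T_space[of k b]
      by (intro outer_measure_of_mono) (auto simp: Z_def)
    finally show ?thesis using Z_sets by simp
  qed
  then have "c \<le> (INF k. emeasure M (Z k))" by (simp add: INF_greatest)
  also have "\<dots> = emeasure M (\<Inter>k. Z k)"
    using Z_sets by (intro INF_emeasure_decseq[OF _ \<open>decseq Z\<close>]) (auto simp: emeasure_eq_measure)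
  finally have "c \<le> emeasure M (\<Inter>k. Z k)" .
  moreover have "(\<Inter>k. Z k) \<subseteq> h ` {x. \<exists>f. (x, f) \<in> C}"
  proof
    fix y assume y: "y \<in> (\<Inter>k. Z k)"
    have "\<exists>x f. (x, f) \<in> C \<and> (\<forall>i<k. f i \<le> b i) \<and> dist (h x) y < 1 / Suc k" for k
    proof -
      have "y \<in> closure (T k b)" using y by (auto simp: Z_def)
      then have "\<exists>z\<in>T k b. dist z y < 1 / Suc k"
        unfolding closure_approachable by (rule allE[of _ "1 / Suc k"]) simp
      then show ?thesis by (auto simp: T_def)
    qed
    then obtain xs fs where xf: "\<And>k. (xs k, fs k) \<in> C" "\<And>k i. i < k \<Longrightarrow> fs k i \<le> b i"
        "\<And>k. dist (h (xs k)) y < 1 / Suc k" by metis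
    \<comment> \<open>Only the first \<open>k\<close> entries of \<open>fs k\<close> are bounded by
      \<open>b\<close>. Truncation puts all codes into one compact box, and a fixed entry is altered
      for finitely many \<open>k\<close> only, so \<open>fs\<close> converges along the same
      subsequence.\<close>
    define gs where "gs k i = min (fs k i) (b i)" for k i
    have "compact (B \<times> Pi\<^sub>E UNIV (\<lambda>i. {..b i}))"
      by (intro compact_Times C compact_PiE_UNIV) (simp add: finite_imp_compact)
    moreover have "\<forall>k. (xs k, gs k) \<in> B \<times> Pi\<^sub>E UNIV (\<lambda>i. {..b i})"
      using xf(1) C(2) by (auto simp: gs_def)
    ultimately obtain l r where lr: "l \<in> B \<times> Pi\<^sub>E UNIV (\<lambda>i. {..b i})" "strict_mono r"
        "((\<lambda>k. (xs k, gs k)) \<circ> r) \<longlonglongrightarrow> l"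
      by (rule seq_compactE[OF compact_imp_seq_compact])
    obtain x f where l: "l = (x, f)" by (cases l)
    have xs: "(\<lambda>k. xs (r k)) \<longlonglongrightarrow> x" and gs: "(\<lambda>k. gs (r k)) \<longlonglongrightarrow> f"
      using tendsto_fst[OF lr(3)] tendsto_snd[OF lr(3)] unfolding l o_def fst_conv snd_conv .
    have "(\<lambda>k. fs (r k)) \<longlonglongrightarrow> f"
      unfolding tendsto_fun_iff
    proof
      fix i
      have "eventually (\<lambda>k. gs (r k) i = fs (r k) i) sequentially"
        using eventually_gt_at_top[of i]
      proof eventually_elim
        case (elim k)
        then have "i < r k" using seq_suble[OF lr(2), of k] by linarith
        then show ?case using xf(2)[of i "r k"] by (simp add: gs_def)
      qed
      moreover have "(\<lambda>k. gs (r k) i) \<longlonglongrightarrow> f i" using gs[unfolded tendsto_fun_iff] by (rule spec)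
      ultimately show "(\<lambda>k. fs (r k) i) \<longlonglongrightarrow> f i" by (rule Lim_transform_eventually[rotated])
    qed
    with xs have "(\<lambda>k. (xs (r k), fs (r k))) \<longlonglongrightarrow> (x, f)" by (rule tendsto_Pair)
    then have xfC: "(x, f) \<in> C"
      using closed_sequentially[OF C(1), of "\<lambda>k. (xs (r k), fs (r k))"] xf(1) by blast
    have "(\<lambda>k. h (xs (r k))) \<longlonglongrightarrow> h x"
      using xf(1) C(2) lr(1) l by (intro continuous_on_tendsto_compose[OF h(1) xs] always_eventually) auto
    moreover have "(\<lambda>k. h (xs (r k))) \<longlonglongrightarrow> y"
    proof -
      have "(\<lambda>k. h (xs k)) \<longlonglongrightarrow> y"
        unfolding tendsto_dist_iff[of "\<lambda>k. h (xs k)"]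
        by (rule tendsto_sandwich[OF _ _ tendsto_const LIMSEQ_Suc[OF lim_1_over_n]])
           (use xf(3) in \<open>auto intro!: always_eventually less_imp_le\<close>)
      then show ?thesis using LIMSEQ_subseq_LIMSEQ[OF _ lr(2)] by (fastforce simp: o_def)
    qed
    ultimately have "y = h x" using LIMSEQ_unique by blast
    then show "y \<in> h ` {x. \<exists>f. (x, f) \<in> C}" using xfC by blast
  qed
  ultimately show ?thesis using Z_sets by (intro bexI[of _ "\<Inter>k. Z k"]) auto
qed

text \<open>Restriction to \<open>K\<close> is continuous, so capacitability applies to the part of
  \<open>A\<close> in each compact box; the boxes exhaust \<open>A\<close>, and countably many null
  sets unite to a null set.\<close>

theorem restrict_image_null_gap:
  fixes M :: "'i::countable \<Rightarrow> real measure"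
  assumes prob: "\<And>i. i \<in> K \<Longrightarrow> prob_space (M i)" "\<And>i. i \<in> K \<Longrightarrow> sets (M i) = sets borel"
    and I: "finite I" and A: "A \<in> sets (Pi\<^sub>M I (\<lambda>_. borel :: real measure))"
  defines "E \<equiv> (\<lambda>x. restrict x K) ` A"
  shows "\<exists>Z\<in>sets (Pi\<^sub>M K M). \<exists>N\<in>null_sets (Pi\<^sub>M K M). Z \<subseteq> E \<and> E \<subseteq> Z \<union> N"
proof -
  let ?M = "Pi\<^sub>M K M" and ?h = "\<lambda>x. restrict x K :: 'i \<Rightarrow> real"
  have "prob_space ?M" using prob by (intro prob_space_PiM) auto
  then interpret prob_space ?M .
  have space: "space ?M = K \<rightarrow>\<^sub>E UNIV"
    using sets_eq_imp_space_eq[OF prob(2)] by (auto simp: space_PiM intro!: PiE_cong)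
  have A_sub: "A \<subseteq> I \<rightarrow>\<^sub>E UNIV" using sets.sets_into_space[OF A] by (simp add: space_PiM)
  \<comment> \<open>Through this inclusion into the full function space, the trace of every closed
    set becomes measurable for the product measure.\<close>
  have emb: "(\<lambda>x. x) \<in> ?M \<rightarrow>\<^sub>M borel"
  proof (rule measurable_coordinatewise_then_product)
    fix i
    show "(\<lambda>x. x i) \<in> borel_measurable ?M"
    proof (cases "i \<in> K")
      case True
      then have "(\<lambda>x. x i) \<in> ?M \<rightarrow>\<^sub>M M i" by measurable
      then show ?thesis using prob(2)[OF True] by (simp cong: measurable_cong_sets)
    next
      case False
      then have "x i = undefined" if "x \<in> space ?M" for x
        using that by (auto simp: space PiE_iff extensional_def)
      then show ?thesis by (subst measurable_cong[of _ _ "\<lambda>_. undefined"]) auto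
    qed
  qed
  have closed_sets: "Z \<inter> space ?M \<in> sets ?M" if "closed Z" for Z
    using measurable_sets[OF emb, of Z] that by simp
  \<comment> \<open>The forced value \<open>undefined\<close> off \<open>I\<close> keeps the box
    compact in the full function space, and the points of \<open>A\<close> have that value
    there.\<close>
  define box where "box n = Pi\<^sub>E UNIV (\<lambda>i. if i \<in> I then {- real n..real n} else {undefined})"
    for n :: nat
  have box: "compact (box n)" for n
    unfolding box_def by (intro compact_PiE_UNIV) auto
  obtain C :: "(('i \<Rightarrow> real) \<times> (nat \<Rightarrow> nat)) set"
    where C: "closed C" "A = {x. \<exists>f. (x, f) \<in> C}"
    using analytic_sets_PiM[OF A] unfolding analytic_def by blast
  have h: "continuous_on S ?h" for S
  proof (intro continuous_on_coordinatewise_then_product)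
    fix i
    show "continuous_on S (\<lambda>x. ?h x i)"
      by (cases "i \<in> K") (auto intro: continuous_on_subset[OF continuous_on_product_coordinates])
  qed
  define C' where "C' n = C \<inter> box n \<times> UNIV" for n
  define A' where "A' n = {x. \<exists>f. (x, f) \<in> C' n}" for n
  have gap: "\<exists>Z\<in>sets ?M. \<exists>N\<in>null_sets ?M. Z \<subseteq> ?h ` A' n \<and> ?h ` A' n \<subseteq> Z \<union> N" for n
  proof (rule null_gap_if_inner_approx)
    show "?h ` A' n \<subseteq> space ?M" by (auto simp: space)
    show "\<exists>Z\<in>sets ?M. Z \<subseteq> ?h ` A' n \<and> c \<le> emeasure ?M Z" if "c < outer_measure_of ?M (?h ` A' n)" for c
      unfolding A'_def
    proof (rule compact_analytic_image_inner_approx[where B = "box n"])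
      show "closed (C' n)"
        unfolding C'_def using C compact_imp_closed[OF box] by (intro closed_Int closed_Times) auto
    qed (use that box h closed_sets finite_measure_axioms in \<open>auto simp: A'_def C'_def space\<close>)
  qed (rule finite_measure_axioms)
  obtain Z N where ZN: "\<And>n. Z n \<in> sets ?M" "\<And>n. N n \<in> null_sets ?M"
      "\<And>n. Z n \<subseteq> ?h ` A' n" "\<And>n. ?h ` A' n \<subseteq> Z n \<union> N n"
  proof -
    have "\<forall>n. \<exists>ZN. fst ZN \<in> sets ?M \<and> snd ZN \<in> null_sets ?M \<and>
        fst ZN \<subseteq> ?h ` A' n \<and> ?h ` A' n \<subseteq> fst ZN \<union> snd ZN"
    proof
      fix n
      from gap[of n] obtain Z N where "Z \<in> sets ?M" "N \<in> null_sets ?M"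
          "Z \<subseteq> ?h ` A' n" "?h ` A' n \<subseteq> Z \<union> N"
        by blast
      then show "\<exists>ZN. fst ZN \<in> sets ?M \<and> snd ZN \<in> null_sets ?M \<and>
          fst ZN \<subseteq> ?h ` A' n \<and> ?h ` A' n \<subseteq> fst ZN \<union> snd ZN"
        by (intro exI[of _ "(Z, N)"]) simp
    qed
    from choice[OF this] obtain ZN where "\<forall>n. fst (ZN n) \<in> sets ?M \<and> snd (ZN n) \<in> null_sets ?M \<and>
        fst (ZN n) \<subseteq> ?h ` A' n \<and> ?h ` A' n \<subseteq> fst (ZN n) \<union> snd (ZN n)" ..
    then show thesis by (intro that[of "\<lambda>n. fst (ZN n)" "\<lambda>n. snd (ZN n)"]) blast+
  qed
  have "A \<subseteq> (\<Union>n. box n)"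
  proof
    fix x assume x: "x \<in> A"
    obtain n :: nat where n: "(\<Sum>i\<in>I. \<bar>x i\<bar>) \<le> real n" using real_arch_simple by blast
    have "\<bar>x i\<bar> \<le> real n" if "i \<in> I" for i
      using member_le_sum[of i I "\<lambda>i. \<bar>x i\<bar>"] that I n by force
    then have "x \<in> box n" using x A_sub by (fastforce simp: box_def PiE_iff extensional_def abs_le_iff)
    then show "x \<in> (\<Union>n. box n)" by blast
  qed
  then have "A = (\<Union>n. A \<inter> box n)"
    by blast
  also have "\<dots> = (\<Union>n. A' n)"
    unfolding C(2) A'_def C'_def by blast
  finally have E_eq: "E = (\<Union>n. ?h ` A' n)"
    unfolding E_def image_UN[symmetric] by (rule arg_cong)
  have "(\<Union>n. Z n) \<subseteq> E" "E \<subseteq> (\<Union>n. Z n) \<union> (\<Union>n. N n)"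
    unfolding E_eq UN_Un_distrib[symmetric] using ZN(3,4) by (intro UN_mono; simp)+
  moreover have "(\<Union>n. Z n) \<in> sets ?M" "(\<Union>n. N n) \<in> null_sets ?M"
    using ZN(1,2) by (auto intro: null_sets_UN)
  ultimately show ?thesis
    by (intro bexI[of _ "\<Union>n. Z n"] bexI[of _ "\<Union>n. N n"] conjI)
qed

section \<open>Measurable cylinders in product spaces\<close>

definition cylinder :: "('i \<Rightarrow> 'a) set \<Rightarrow> 'i set \<Rightarrow> ('i \<Rightarrow> 'a) set \<Rightarrow> bool" where
  "cylinder \<Omega> K F \<longleftrightarrow> F \<subseteq> \<Omega> \<and> (\<forall>x\<in>F. \<forall>y\<in>\<Omega>. (\<forall>i\<in>K. y i = x i) \<longrightarrow> y \<in> F)"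

lemma cylinderD: "cylinder \<Omega> K F \<Longrightarrow> x \<in> F \<Longrightarrow> y \<in> \<Omega> \<Longrightarrow> (\<And>i. i \<in> K \<Longrightarrow> y i = x i) \<Longrightarrow> y \<in> F"
  by (auto simp: cylinder_def)

lemma cylinder_subset: "cylinder \<Omega> K F \<Longrightarrow> F \<subseteq> \<Omega>"
  by (simp add: cylinder_def)

lemma cylinder_Diff: "cylinder \<Omega> K F \<Longrightarrow> cylinder \<Omega> K (\<Omega> - F)"
  unfolding cylinder_def by (metis DiffD1 DiffD2 DiffI Diff_subset)

lemma cylinder_UN: "(\<And>j. j \<in> J \<Longrightarrow> cylinder \<Omega> K (F j)) \<Longrightarrow> cylinder \<Omega> K (\<Union>j\<in>J. F j)"
  unfolding cylinder_def by blast

lemma cylinder_Int: "cylinder \<Omega> K F \<Longrightarrow> cylinder \<Omega> K G \<Longrightarrow> cylinder \<Omega> K (F \<inter> G)"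
  unfolding cylinder_def by blast

lemma cylinder_mono: "cylinder \<Omega> J F \<Longrightarrow> J \<subseteq> K \<Longrightarrow> cylinder \<Omega> K F"
  unfolding cylinder_def by blast

text \<open>The index \<open>K\<close> of a cylinder containing \<open>x\<close> is the witness. Any
  cylinders are allowed, not only the largest ones inside an event, because approximation does not
  preserve maximality.\<close>

lemma reimer_grid_cylinder:
  fixes I :: "'i set" and k :: nat
  defines "\<Omega> \<equiv> I \<rightarrow>\<^sub>E {..<2 ^ k :: nat}"
  assumes I: "finite I" and T: "\<And>K. K \<subseteq> I \<Longrightarrow> cylinder \<Omega> K (T K)" and U: "\<And>K. K \<subseteq> I \<Longrightarrow> cylinder \<Omega> K (U K)"
  shows "card (\<Union>K\<in>Pow I. T K \<inter> U (I - K)) * card \<Omega> \<le> card (\<Union>K\<in>Pow I. T K) * card (\<Union>K\<in>Pow I. U K)"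
proof -
  have sub: "T K \<subseteq> \<Omega>" "U K \<subseteq> \<Omega>" if "K \<subseteq> I" for K
    using cylinder_subset[OF T[OF that]] cylinder_subset[OF U[OF that]] .
  show ?thesis
    unfolding \<Omega>_def
  proof (rule reimer_grid[OF I])
    fix x assume "x \<in> (\<Union>K\<in>Pow I. T K \<inter> U (I - K))"
    then obtain K where K: "K \<subseteq> I" "x \<in> T K" "x \<in> U (I - K)" by blast
    have "y \<in> T K" if "y \<in> \<Omega>" "\<forall>i\<in>K. y i = x i" for y
      using cylinderD[OF T[OF K(1)] K(2) that(1)] that(2) by blast
    moreover have "y \<in> U (I - K)" if "y \<in> \<Omega>" "\<forall>i\<in>I - K. y i = x i" for y
      using cylinderD[OF U[OF Diff_subset] K(3) that(1)] that(2) by blast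
    ultimately show "\<exists>S. (\<forall>y\<in>I \<rightarrow>\<^sub>E {..<2 ^ k}. (\<forall>i\<in>S. y i = x i) \<longrightarrow> y \<in> (\<Union>K\<in>Pow I. T K)) \<and>
         (\<forall>y\<in>I \<rightarrow>\<^sub>E {..<2 ^ k}. (\<forall>i\<in>I - S. y i = x i) \<longrightarrow> y \<in> (\<Union>K\<in>Pow I. U K))"
      unfolding \<Omega>_def[symmetric] using K(1) by (intro exI[of _ K]) blast
  qed (use sub \<Omega>_def in blast)+
qed

section \<open>Quantile functions and dyadic discretization\<close>

text \<open>The interval is open because quantiles at the levels 0 and 1 may be infinite.\<close>

abbreviation unit_lebesgue :: "real measure" where
  "unit_lebesgue \<equiv> restrict_space lborel {0<..<1}"

lemma prob_space_unit_lebesgue: "prob_space unit_lebesgue"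
  by (auto simp: emeasure_restrict_space space_restrict_space intro!: prob_spaceI)

lemma ex_quantile_function:
  fixes \<mu> :: "real measure"
  assumes "prob_space \<mu>" "sets \<mu> = sets borel"
  shows "\<exists>q\<in>borel_measurable unit_lebesgue. distr unit_lebesgue borel q = \<mu>"
proof -
  interpret prob_space \<mu> by fact
  \<comment> \<open>This locale supplies \<open>I\<close>, the generalized inverse of the
    distribution function.\<close>
  interpret cdf_distribution \<mu>
    by unfold_locales (simp_all add: assms(2) sets_eq_imp_space_eq[OF assms(2)])
  show ?thesis
  proof
    show "distr unit_lebesgue borel I = \<mu>" by (rule distr_I_eq_M)
    show "I \<in> borel_measurable unit_lebesgue"
      using measurable_CI by (simp cong: measurable_cong_sets add: sets_restrict_space)
  qed
qed

text \<open>Index of the dyadic interval of length \<open>1 / 2 ^ k\<close> that contains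
  \<open>x\<close>, not a single binary digit.\<close>

definition dyadic_digit :: "nat \<Rightarrow> real \<Rightarrow> nat" where
  "dyadic_digit k x = nat \<lfloor>2 ^ k * x\<rfloor>"

lemma dyadic_digit_less: "x \<in> {0<..<1} \<Longrightarrow> dyadic_digit k x < 2 ^ k"
  unfolding dyadic_digit_def by (auto simp: nat_less_iff floor_less_iff)

lemma measurable_dyadic_digit [measurable]: "dyadic_digit k \<in> borel \<rightarrow>\<^sub>M count_space UNIV"
  unfolding dyadic_digit_def by measurable

lemma measurable_dyadic_digit_unit [measurable]: "dyadic_digit k \<in> unit_lebesgue \<rightarrow>\<^sub>M count_space UNIV"
  by (rule measurable_restrict_space1) simp

lemma emeasure_dyadic_digit:
  "emeasure unit_lebesgue {x \<in> {0<..<1}. dyadic_digit k x = m} = (if m < 2 ^ k then ennreal (1 / 2 ^ k) else 0)"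
proof (cases "m < 2 ^ k")
  case True
  then have m: "real m + 1 \<le> 2 ^ k"
    by (metis Suc_leI of_nat_Suc of_nat_le_iff of_nat_numeral of_nat_power add.commute)
  \<comment> \<open>Removing 0 matters only for \<open>m = 0\<close>, whose half-open interval
    contains the endpoint missing from the unit interval.\<close>
  have eq: "{x \<in> {0<..<1}. dyadic_digit k x = m} = {real m / 2 ^ k..<(real m + 1) / 2 ^ k} - {0}"
  proof (intro set_eqI iffI)
    fix x assume x: "x \<in> {x \<in> {0<..<1}. dyadic_digit k x = m}"
    then have "\<lfloor>2 ^ k * x\<rfloor> = int m" unfolding dyadic_digit_def by (auto simp: nat_eq_iff)
    then have "real m \<le> 2 ^ k * x \<and> 2 ^ k * x < real m + 1" by (simp add: floor_eq_iff)
    then show "x \<in> {real m / 2 ^ k..<(real m + 1) / 2 ^ k} - {0}"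
      using x by (auto simp: field_simps)
  next
    fix x assume x: "x \<in> {real m / 2 ^ k..<(real m + 1) / 2 ^ k} - {0}"
    then have *: "real m \<le> 2 ^ k * x" "2 ^ k * x < real m + 1" "x \<noteq> 0" by (auto simp: field_simps)
    then have "\<lfloor>2 ^ k * x\<rfloor> = int m" by (simp add: floor_eq_iff)
    moreover have "0 < x"
    proof (rule ccontr)
      assume "\<not> 0 < x"
      then have lt: "2 ^ k * x < 0" using *(3) by (intro mult_pos_neg) auto
      have "0 \<le> 2 ^ k * x" by (rule order_trans[OF of_nat_0_le_iff *(1)])
      from leD[OF this] lt show False by (rule notE)
    qed
    moreover have "x < 1"
    proof (rule ccontr)
      assume "\<not> x < 1"
      then have "2 ^ k * 1 \<le> 2 ^ k * x" by (intro mult_left_mono) auto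
      with *(2) m show False by simp
    qed
    ultimately show "x \<in> {x \<in> {0<..<1}. dyadic_digit k x = m}"
      by (simp add: dyadic_digit_def)
  qed
  have "emeasure lborel ({real m / 2 ^ k..<(real m + 1) / 2 ^ k} - {0}) = ennreal (1 / 2 ^ k)"
  proof -
    have "emeasure lborel ({real m / 2 ^ k..<(real m + 1) / 2 ^ k} - {0}) =
        emeasure lborel {real m / 2 ^ k..<(real m + 1) / 2 ^ k}"
      by (rule emeasure_Diff_null_set) auto
    also have "\<dots> = ennreal ((real m + 1) / 2 ^ k - real m / 2 ^ k)"
      by (simp add: divide_right_mono)
    finally show ?thesis by (simp add: diff_divide_distrib[symmetric])
  qed
  moreover have "emeasure unit_lebesgue {x \<in> {0<..<1}. dyadic_digit k x = m} =
      emeasure lborel {x \<in> {0<..<1}. dyadic_digit k x = m}"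
    by (rule emeasure_restrict_space) auto
  ultimately show ?thesis
    using True by (simp only: eq if_True)
next
  case False
  then have "dyadic_digit k x \<noteq> m" if "x \<in> {0<..<1}" for x
    using dyadic_digit_less[OF that, of k] by auto
  then have empty: "{x \<in> {0<..<1}. dyadic_digit k x = m} = {}"
    by blast
  show ?thesis unfolding empty using False by simp
qed

context
  fixes I :: "'i set"
  assumes finite_I: "finite I"
begin

abbreviation "cube \<equiv> Pi\<^sub>M I (\<lambda>_. unit_lebesgue)"

abbreviation "grid k \<equiv> I \<rightarrow>\<^sub>E {..<2 ^ k :: nat}"

text \<open>
  Every Borel probability measure on the line is an image of Lebesgue measure on the unit interval, so
  it is enough to treat the cube, where a measurable cylinder is close in measure to a union of
  dyadic boxes that is a cylinder over the same coordinates, and Reimer's inequality applies to the grid.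
\<close>

definition digits :: "nat \<Rightarrow> ('i \<Rightarrow> real) \<Rightarrow> 'i \<Rightarrow> nat" where
  "digits k \<omega> = (\<lambda>i\<in>I. dyadic_digit k (\<omega> i))"

definition grid_set :: "nat \<Rightarrow> ('i \<Rightarrow> nat) set \<Rightarrow> ('i \<Rightarrow> real) set" where
  "grid_set k T = {\<omega> \<in> space cube. digits k \<omega> \<in> T}"

lemma prob_space_cube: "prob_space cube"
  by (intro prob_space_PiM prob_space_unit_lebesgue)

interpretation cube: prob_space cube by (rule prob_space_cube)

lemma space_cube: "space cube = I \<rightarrow>\<^sub>E {0<..<1}"
  by (simp add: space_PiM space_restrict_space)

lemma digits_in_grid: "\<omega> \<in> space cube \<Longrightarrow> digits k \<omega> \<in> grid k"
  by (auto simp: digits_def space_cube PiE_iff dyadic_digit_less)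

lemma finite_grid: "finite (grid k)"
  using finite_I by (intro finite_PiE) auto

lemma card_grid: "card (grid k) = (2 ^ k) ^ card I"
  using finite_I by (simp add: card_PiE)

lemma grid_set_single:
  assumes "\<tau> \<in> grid k"
  shows "grid_set k {\<tau>} \<in> sets cube" "measure cube (grid_set k {\<tau>}) = 1 / card (grid k)"
proof -
  interpret U: prob_space unit_lebesgue by (rule prob_space_unit_lebesgue)
  interpret product_sigma_finite "\<lambda>_::'i. unit_lebesgue" ..
  let ?B = "\<lambda>i. {x \<in> {0<..<1}. dyadic_digit k x = \<tau> i}"
  have eq: "grid_set k {\<tau>} = Pi\<^sub>E I ?B"
  proof (intro set_eqI iffI)
    fix \<omega> assume "\<omega> \<in> grid_set k {\<tau>}"
    then have "\<omega> \<in> space cube" "digits k \<omega> = \<tau>" by (auto simp: grid_set_def)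
    then show "\<omega> \<in> Pi\<^sub>E I ?B" by (auto simp: space_cube digits_def PiE_iff)
  next
    fix \<omega> assume \<omega>: "\<omega> \<in> Pi\<^sub>E I ?B"
    then have "digits k \<omega> = \<tau>"
      using assms by (intro ext) (auto simp: digits_def PiE_iff extensional_def)
    with \<omega> show "\<omega> \<in> grid_set k {\<tau>}" by (auto simp: grid_set_def space_cube PiE_iff)
  qed
  have B: "?B i \<in> sets unit_lebesgue" for i
  proof -
    have "?B i = {x \<in> space unit_lebesgue. dyadic_digit k x = \<tau> i}" by (simp add: space_restrict_space)
    also have "\<dots> \<in> sets unit_lebesgue" by measurable
    finally show ?thesis .
  qed
  show "grid_set k {\<tau>} \<in> sets cube"
    unfolding eq using B finite_I by (intro sets_PiM_I_finite)
  have "emeasure cube (grid_set k {\<tau>}) = (\<Prod>i\<in>I. emeasure unit_lebesgue (?B i))"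
    unfolding eq using B finite_I by (intro emeasure_PiM)
  also have "\<dots> = (\<Prod>i\<in>I. ennreal (1 / 2 ^ k))"
    using assms by (intro prod.cong refl, subst emeasure_dyadic_digit) (auto simp: PiE_iff)
  also have "\<dots> = ennreal (1 / card (grid k))"
    unfolding card_grid by (simp add: ennreal_power power_divide)
  finally show "measure cube (grid_set k {\<tau>}) = 1 / card (grid k)"
    by (simp add: measure_def)
qed

lemma grid_set_UN: "grid_set k (\<Union>j\<in>J. T j) = (\<Union>j\<in>J. grid_set k (T j))"
  by (auto simp: grid_set_def)

lemma grid_set:
  assumes "T \<subseteq> grid k"
  shows "grid_set k T \<in> sets cube" "measure cube (grid_set k T) = card T / card (grid k)"
proof -
  have fin: "finite T" using assms finite_grid by (rule finite_subset)
  have eq: "grid_set k T = (\<Union>\<tau>\<in>T. grid_set k {\<tau>})"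
    by (auto simp: grid_set_def)
  show "grid_set k T \<in> sets cube"
    unfolding eq using fin assms grid_set_single(1) by (intro sets.finite_UN) auto
  have "measure cube (grid_set k T) = (\<Sum>\<tau>\<in>T. measure cube (grid_set k {\<tau>}))"
    unfolding eq using fin assms grid_set_single(1)
    by (intro cube.finite_measure_finite_Union) (auto simp: disjoint_family_on_def grid_set_def)
  also have "\<dots> = (\<Sum>\<tau>\<in>T. 1 / card (grid k))"
    using assms grid_set_single(2) by (intro sum.cong) auto
  finally show "measure cube (grid_set k T) = card T / card (grid k)" by simp
qed

section \<open>Approximation of measurable cylinders by grid cylinders\<close>

text \<open>Approximation is demanded for all large \<open>k\<close>, not for some, so that finitely
  many cylinders share a common resolution. The approximant must be a cylinder over the same
  \<open>K\<close> for Reimer's inequality to apply.\<close>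

definition grid_approximable :: "'i set \<Rightarrow> ('i \<Rightarrow> real) set \<Rightarrow> bool" where
  "grid_approximable K F \<longleftrightarrow> F \<in> sets cube \<and>
     (\<forall>\<epsilon>>0. \<forall>\<^sub>F k in sequentially. \<exists>T. cylinder (grid k) K T \<and>
        measure cube (sym_diff F (grid_set k T)) < \<epsilon>)"

lemma grid_approximable_empty: "grid_approximable K {}"
  unfolding grid_approximable_def
  by (intro conjI allI impI always_eventually exI[of _ "{}"]) (auto simp: cylinder_def grid_set_def)

lemma grid_approximable_Diff:
  assumes "grid_approximable K F"
  shows "grid_approximable K (space cube - F)"
  unfolding grid_approximable_def
proof (intro conjI allI impI)
  show "space cube - F \<in> sets cube" using assms by (auto simp: grid_approximable_def)
  fix \<epsilon> :: real assume "\<epsilon> > 0"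
  with assms have "\<forall>\<^sub>F k in sequentially. \<exists>T. cylinder (grid k) K T \<and> measure cube (sym_diff F (grid_set k T)) < \<epsilon>"
    by (simp add: grid_approximable_def)
  then show "\<forall>\<^sub>F k in sequentially. \<exists>T. cylinder (grid k) K T \<and>
      measure cube (sym_diff (space cube - F) (grid_set k T)) < \<epsilon>"
  proof eventually_elim
    case (elim k)
    then obtain T where T: "cylinder (grid k) K T" "measure cube (sym_diff F (grid_set k T)) < \<epsilon>" by blast
    have "F \<subseteq> space cube" using assms sets.sets_into_space by (auto simp: grid_approximable_def)
    moreover have "grid_set k (grid k - T) = space cube - grid_set k T"
      using digits_in_grid by (auto simp: grid_set_def)
    moreover have "grid_set k T \<subseteq> space cube" by (auto simp: grid_set_def)
    ultimately have "sym_diff (space cube - F) (grid_set k (grid k - T)) = sym_diff F (grid_set k T)"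
      by blast
    then show ?case using T cylinder_Diff[OF T(1)] by (intro exI[of _ "grid k - T"]) simp
  qed
qed

text \<open>A finite partial union misses less than \<open>\<epsilon> / 2\<close> of the measure,
  and the errors of its members share the other half.\<close>

lemma grid_approximable_UN:
  fixes F :: "nat \<Rightarrow> ('i \<Rightarrow> real) set"
  assumes F: "\<And>n. grid_approximable K (F n)"
  shows "grid_approximable K (\<Union>n. F n)"
  unfolding grid_approximable_def
proof (intro conjI allI impI)
  have sets_F: "F n \<in> sets cube" for n using F by (simp add: grid_approximable_def)
  then show sets_UN: "(\<Union>n. F n) \<in> sets cube" by auto
  fix \<epsilon> :: real assume \<epsilon>: "\<epsilon> > 0"
  have "(\<lambda>N. measure cube (\<Union>n<N. F n)) \<longlonglongrightarrow> measure cube (\<Union>N. \<Union>n<N. F n)"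
    using sets_F by (intro cube.finite_Lim_measure_incseq) (auto simp: incseq_def intro: less_le_trans)
  also have "(\<Union>N. \<Union>n<N. F n) = (\<Union>n. F n)" by blast
  finally have "\<forall>\<^sub>F N in sequentially. measure cube (\<Union>n. F n) - \<epsilon> / 2 < measure cube (\<Union>n<N. F n)"
    using \<epsilon> by (intro order_tendstoD(1)) auto
  then obtain N where N: "measure cube (\<Union>n. F n) - \<epsilon> / 2 < measure cube (\<Union>n<N. F n)"
    by (auto simp: eventually_sequentially)
  define R where "R = (\<Union>n. F n) - (\<Union>n<N. F n)"
  have R: "R \<in> sets cube" "measure cube R < \<epsilon> / 2"
  proof -
    show "R \<in> sets cube" using sets_F by (auto simp: R_def)
    have "measure cube R = measure cube (\<Union>n. F n) - measure cube (\<Union>n<N. F n)"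
      unfolding R_def using sets_F by (intro cube.finite_measure_Diff) auto
    then show "measure cube R < \<epsilon> / 2" using N by simp
  qed
  define \<delta> where "\<delta> = \<epsilon> / (2 * Suc N)"
  have "\<delta> > 0" using \<epsilon> by (simp add: \<delta>_def)
  then have "\<forall>\<^sub>F k in sequentially. \<forall>n\<in>{..<N}. \<exists>T. cylinder (grid k) K T \<and>
      measure cube (sym_diff (F n) (grid_set k T)) < \<delta>"
    using F by (intro eventually_ball_finite) (auto simp: grid_approximable_def)
  then show "\<forall>\<^sub>F k in sequentially. \<exists>T. cylinder (grid k) K T \<and>
      measure cube (sym_diff (\<Union>n. F n) (grid_set k T)) < \<epsilon>"
  proof eventually_elim
    case (elim k)
    from bchoice[OF elim] obtain T where
      T: "\<And>n. n < N \<Longrightarrow> cylinder (grid k) K (T n)"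
         "\<And>n. n < N \<Longrightarrow> measure cube (sym_diff (F n) (grid_set k (T n))) < \<delta>" by auto
    have gs: "grid_set k (T n) \<in> sets cube" if "n < N" for n
      using grid_set(1)[OF cylinder_subset[OF T(1)[OF that]]] .
    define D where "D n = sym_diff (F n) (grid_set k (T n))" for n
    have "sym_diff (\<Union>n. F n) (grid_set k (\<Union>n<N. T n)) \<subseteq> R \<union> (\<Union>n<N. D n)"
      unfolding grid_set_UN R_def D_def by blast
    moreover have D_sets: "D n \<in> sets cube" if "n < N" for n unfolding D_def using gs[OF that] sets_F by auto
    ultimately have "measure cube (sym_diff (\<Union>n. F n) (grid_set k (\<Union>n<N. T n))) \<le>
        measure cube (R \<union> (\<Union>n<N. D n))"
      using R by (intro cube.finite_measure_mono sets.Un sets.finite_UN) auto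
    also have "\<dots> \<le> measure cube R + measure cube (\<Union>n<N. D n)"
      using R D_sets by (intro measure_Un_le sets.finite_UN) auto
    also have "measure cube (\<Union>n<N. D n) \<le> (\<Sum>n<N. measure cube (D n))"
      using D_sets by (intro cube.finite_measure_subadditive_finite) auto
    also have "\<dots> \<le> (\<Sum>n<N. \<delta>)"
      using T(2) unfolding D_def by (intro sum_mono) (auto intro: less_imp_le)
    also have "\<dots> \<le> \<epsilon> / 2"
      using \<epsilon> by (simp add: \<delta>_def field_simps)
    finally have "measure cube (sym_diff (\<Union>n. F n) (grid_set k (\<Union>n<N. T n))) < \<epsilon>"
      using R(2) by simp
    moreover have "cylinder (grid k) K (\<Union>n<N. T n)"
      using T(1) by (intro cylinder_UN) auto
    ultimately show ?case by blast
  qed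
qed

lemma grid_approximable_halfspace:
  assumes i: "i \<in> K" "K \<subseteq> I"
  shows "grid_approximable K {\<omega> \<in> space cube. \<omega> i \<le> a}"
  unfolding grid_approximable_def
proof (intro conjI allI impI)
  have iI: "i \<in> I" using i by blast
  have comp: "(\<lambda>\<omega>. \<omega> i) \<in> cube \<rightarrow>\<^sub>M unit_lebesgue" using iI by measurable
  have "(\<lambda>\<omega>. \<omega> i) \<in> borel_measurable cube"
    by (rule measurable_compose[OF comp]) (auto intro: measurable_restrict_space1)
  then show sets_H: "{\<omega> \<in> space cube. \<omega> i \<le> a} \<in> sets cube" by measurable
  fix \<epsilon> :: real assume "\<epsilon> > 0"
  then have "\<forall>\<^sub>F k in sequentially. (1 / 2) ^ k < \<epsilon>"
    by (intro order_tendstoD(2)[OF LIMSEQ_realpow_zero]) auto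
  then show "\<forall>\<^sub>F k in sequentially. \<exists>T. cylinder (grid k) K T \<and>
      measure cube (sym_diff {\<omega> \<in> space cube. \<omega> i \<le> a} (grid_set k T)) < \<epsilon>"
  proof eventually_elim
    case (elim k)
    \<comment> \<open>\<open>T\<close> keeps the cells whose left end is at most \<open>a\<close>.
      They cover the half-space, and the excess lies in the layer of cells whose interval contains
      \<open>a\<close>, of measure at most \<open>1 / 2 ^ k\<close>.\<close>
    define T where "T = {\<tau> \<in> grid k. real (\<tau> i) \<le> 2 ^ k * a}"
    have T: "cylinder (grid k) K T" using i by (auto simp: cylinder_def T_def)
    define m where "m = nat \<lfloor>2 ^ k * a\<rfloor>"
    let ?B = "{x \<in> {0<..<1}. dyadic_digit k x = m}"
    let ?E = "(\<lambda>\<omega>. \<omega> i) -` ?B \<inter> space cube"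
    have "?B = {x \<in> space unit_lebesgue. dyadic_digit k x = m}" by (simp add: space_restrict_space)
    also have "\<dots> \<in> sets unit_lebesgue" by measurable
    finally have B: "?B \<in> sets unit_lebesgue" .
    have "sym_diff {\<omega> \<in> space cube. \<omega> i \<le> a} (grid_set k T) \<subseteq> ?E"
    proof
      fix \<omega> assume \<omega>: "\<omega> \<in> sym_diff {\<omega> \<in> space cube. \<omega> i \<le> a} (grid_set k T)"
      then have sp: "\<omega> \<in> space cube" by (auto simp: grid_set_def)
      then have pos: "0 < \<omega> i" "\<omega> i < 1" using iI by (auto simp: space_cube)
      have "\<omega> \<in> grid_set k T \<longleftrightarrow> real (dyadic_digit k (\<omega> i)) \<le> 2 ^ k * a"
        using sp digits_in_grid[OF sp] iI by (simp add: grid_set_def T_def digits_def)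
      also have "\<dots> \<longleftrightarrow> of_int \<lfloor>2 ^ k * \<omega> i\<rfloor> \<le> 2 ^ k * a"
        using pos by (simp add: dyadic_digit_def)
      finally have in_T: "\<omega> \<in> grid_set k T \<longleftrightarrow> of_int \<lfloor>2 ^ k * \<omega> i\<rfloor> \<le> 2 ^ k * a" .
      have "\<omega> \<in> grid_set k T" if "\<omega> i \<le> a"
      proof -
        have "of_int \<lfloor>2 ^ k * \<omega> i\<rfloor> \<le> 2 ^ k * \<omega> i" by simp
        also have "\<dots> \<le> 2 ^ k * a" using that by simp
        finally show ?thesis by (simp add: in_T)
      qed
      with \<omega> have gt: "\<omega> i > a" and le: "of_int \<lfloor>2 ^ k * \<omega> i\<rfloor> \<le> 2 ^ k * a" using in_T sp by auto
      have "2 ^ k * a < 2 ^ k * \<omega> i" using gt by simp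
      also have "\<dots> < of_int \<lfloor>2 ^ k * \<omega> i\<rfloor> + 1" by linarith
      finally have "\<lfloor>2 ^ k * a\<rfloor> = \<lfloor>2 ^ k * \<omega> i\<rfloor>" using le by (simp add: floor_eq_iff)
      then show "\<omega> \<in> ?E" using sp pos by (simp add: dyadic_digit_def m_def)
    qed
    then have "measure cube (sym_diff {\<omega> \<in> space cube. \<omega> i \<le> a} (grid_set k T)) \<le> measure cube ?E"
      using measurable_sets[OF comp B] by (intro cube.finite_measure_mono)
    also have "\<dots> = measure (distr cube unit_lebesgue (\<lambda>\<omega>. \<omega> i)) ?B"
      using comp B by (simp add: measure_distr)
    also have "\<dots> = measure unit_lebesgue ?B"
      by (simp only: distr_PiM_component[OF prob_space_unit_lebesgue iI])
    also have "\<dots> \<le> (1 / 2) ^ k"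
      unfolding measure_def emeasure_dyadic_digit by (simp add: power_divide)
    finally show ?case using T elim by (intro exI[of _ T]) simp
  qed
qed

text \<open>A cylinder over \<open>K\<close> is its own preimage under the map \<open>\<phi>\<close>
  that resets the coordinates off \<open>K\<close> to 1/2. Measurability of \<open>\<phi>\<close>
  with respect to the approximable sets involves only half-spaces in coordinates of
  \<open>K\<close>.\<close>

lemma cylinder_grid_approximable:
  assumes K: "K \<subseteq> I" and F: "F \<in> sets cube" "cylinder (space cube) K F"
  shows "grid_approximable K F"
proof -
  let ?\<A> = "Collect (grid_approximable K)"
  have sa: "sigma_algebra (space cube) ?\<A>"
    unfolding sigma_algebra_iff2
  proof (intro conjI ballI allI impI)
    show "?\<A> \<subseteq> Pow (space cube)"
    proof
      fix F assume "F \<in> ?\<A>"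
      then have "F \<in> sets cube" by (simp only: mem_Collect_eq grid_approximable_def)
      then show "F \<in> Pow (space cube)" by (intro PowI sets.sets_into_space)
    qed
    show "{} \<in> ?\<A>" using grid_approximable_empty by simp
    show "space cube - F \<in> ?\<A>" if "F \<in> ?\<A>" for F
      using that grid_approximable_Diff by simp
    show "(\<Union>n. F n) \<in> ?\<A>" if "range F \<subseteq> ?\<A>" for F :: "nat \<Rightarrow> _"
    proof -
      have "grid_approximable K (F n)" for n using that by (simp add: range_subsetD image_subset_iff)
      then show ?thesis by (intro CollectI grid_approximable_UN)
    qed
  qed
  define N where "N = sigma (space cube) ?\<A>"
  have N: "space N = space cube" "sets N = ?\<A>"
    unfolding N_def using sa sigma_algebra.sets_measure_of_eq[OF sa]
    by (simp_all add: space_measure_of_conv)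
  define \<phi> where "\<phi> \<omega> = (\<lambda>i\<in>I. if i \<in> K then \<omega> i else 1 / 2)" for \<omega> :: "'i \<Rightarrow> real"
  have \<phi>_space: "\<phi> \<omega> \<in> space cube" if "\<omega> \<in> space cube" for \<omega>
    using that by (auto simp: \<phi>_def space_cube PiE_iff)
  have "\<phi> \<in> N \<rightarrow>\<^sub>M cube"
    unfolding \<phi>_def
  proof (rule measurable_restrict)
    fix i assume "i \<in> I"
    show "(\<lambda>\<omega>. if i \<in> K then \<omega> i else 1 / 2) \<in> N \<rightarrow>\<^sub>M unit_lebesgue"
    proof (cases "i \<in> K")
      case True
      have "(\<lambda>\<omega>. \<omega> i) \<in> borel_measurable N"
        by (rule borel_measurableI_le) (simp add: N grid_approximable_halfspace[OF True K])
      then have "(\<lambda>\<omega>. \<omega> i) \<in> N \<rightarrow>\<^sub>M unit_lebesgue"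
        using \<open>i \<in> I\<close> by (intro measurable_restrict_space2) (auto simp: N space_cube PiE_iff)
      then show ?thesis using True by simp
    qed (auto simp: space_restrict_space)
  qed
  from measurable_sets[OF this F(1)] have "grid_approximable K (\<phi> -` F \<inter> space cube)"
    by (simp add: N)
  also have "\<phi> -` F \<inter> space cube = F"
  proof (intro set_eqI iffI)
    fix \<omega> assume "\<omega> \<in> \<phi> -` F \<inter> space cube"
    then have \<omega>: "\<phi> \<omega> \<in> F" "\<omega> \<in> space cube" by auto
    show "\<omega> \<in> F" by (rule cylinderD[OF F(2) \<omega>]) (use K in \<open>auto simp: \<phi>_def\<close>)
  next
    fix \<omega> assume \<omega>: "\<omega> \<in> F"
    then have sp: "\<omega> \<in> space cube" using cylinder_subset[OF F(2)] by blast
    have "\<phi> \<omega> \<in> F"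
      by (rule cylinderD[OF F(2) \<omega> \<phi>_space[OF sp]]) (use K in \<open>auto simp: \<phi>_def\<close>)
    then show "\<omega> \<in> \<phi> -` F \<inter> space cube" using sp by simp
  qed
  finally show ?thesis .
qed

section \<open>The inequality for two families of cylinders\<close>

text \<open>Both families are approximated at one resolution. Off the set \<open>E\<close> of all
  discrepancies their members coincide with the approximants, so the measure of each union changes
  by at most that of \<open>E\<close>.\<close>

lemma bkr_cube_approx:
  assumes F: "\<And>K. K \<subseteq> I \<Longrightarrow> F K \<in> sets cube" "\<And>K. K \<subseteq> I \<Longrightarrow> cylinder (space cube) K (F K)"
    and G: "\<And>K. K \<subseteq> I \<Longrightarrow> G K \<in> sets cube" "\<And>K. K \<subseteq> I \<Longrightarrow> cylinder (space cube) K (G K)"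
    and \<eta>: "\<eta> > 0"
  shows "measure cube (\<Union>K\<in>Pow I. F K \<inter> G (I - K)) \<le>
    (measure cube (\<Union>K\<in>Pow I. F K) + \<eta>) * (measure cube (\<Union>K\<in>Pow I. G K) + \<eta>) + \<eta>"
proof -
  \<comment> \<open>There are two families of \<open>card (Pow I)\<close> sets each, so the
    discrepancies add up to at most \<open>\<eta>\<close>.\<close>
  define \<delta> where "\<delta> = \<eta> / (2 * card (Pow I))"
  have cardP: "card (Pow I) > 0" using finite_I by (auto simp: card_gt_0_iff)
  then have \<delta>: "\<delta> > 0" using \<eta> by (simp add: \<delta>_def)
  let ?approx = "\<lambda>k K F T. cylinder (grid k) K T \<and> measure cube (sym_diff F (grid_set k T)) < \<delta>"
  have approx: "\<forall>\<^sub>F k in sequentially. \<forall>K\<in>Pow I. \<exists>T. ?approx k K (H K) T"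
    if H: "\<And>K. K \<subseteq> I \<Longrightarrow> H K \<in> sets cube" "\<And>K. K \<subseteq> I \<Longrightarrow> cylinder (space cube) K (H K)" for H
  proof (rule eventually_ball_finite)
    show "finite (Pow I)" using finite_I by simp
    show "\<forall>K\<in>Pow I. \<forall>\<^sub>F k in sequentially. \<exists>T. ?approx k K (H K) T"
    proof
      fix K assume "K \<in> Pow I"
      then have "grid_approximable K (H K)" by (intro cylinder_grid_approximable H) auto
      then show "\<forall>\<^sub>F k in sequentially. \<exists>T. ?approx k K (H K) T"
        using \<delta> unfolding grid_approximable_def by blast
    qed
  qed
  have "\<forall>\<^sub>F k in sequentially. (\<forall>K\<in>Pow I. \<exists>T. ?approx k K (F K) T) \<and> (\<forall>K\<in>Pow I. \<exists>T. ?approx k K (G K) T)"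
    by (intro eventually_conj approx F G)
  from eventually_happens'[OF sequentially_bot this]
  obtain k where kF: "\<forall>K\<in>Pow I. \<exists>T. ?approx k K (F K) T" and kG: "\<forall>K\<in>Pow I. \<exists>T. ?approx k K (G K) T"
    by (elim exE conjE)
  from bchoice[OF kF] obtain T where T: "\<And>K. K \<subseteq> I \<Longrightarrow> cylinder (grid k) K (T K)"
      "\<And>K. K \<subseteq> I \<Longrightarrow> measure cube (sym_diff (F K) (grid_set k (T K))) < \<delta>"
    by auto
  from bchoice[OF kG] obtain U where U: "\<And>K. K \<subseteq> I \<Longrightarrow> cylinder (grid k) K (U K)"
      "\<And>K. K \<subseteq> I \<Longrightarrow> measure cube (sym_diff (G K) (grid_set k (U K))) < \<delta>"
    by auto
  define DT where "DT K = sym_diff (F K) (grid_set k (T K))" for K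
  define DU where "DU K = sym_diff (G K) (grid_set k (U K))" for K
  have D_sets: "DT K \<in> sets cube" "DU K \<in> sets cube" if "K \<subseteq> I" for K
    unfolding DT_def DU_def
    using F(1) G(1) grid_set(1)[OF cylinder_subset[OF T(1)]] grid_set(1)[OF cylinder_subset[OF U(1)]] that
    by auto
  define E where "E = (\<Union>K\<in>Pow I. DT K \<union> DU K)"
  have E_sets: "E \<in> sets cube"
    unfolding E_def using D_sets finite_I by (intro sets.finite_UN) auto
  have "measure cube E \<le> (\<Sum>K\<in>Pow I. measure cube (DT K \<union> DU K))"
    unfolding E_def using D_sets finite_I by (intro cube.finite_measure_subadditive_finite) auto
  also have "\<dots> \<le> (\<Sum>K\<in>Pow I. 2 * \<delta>)"
  proof (rule sum_mono)
    fix K assume "K \<in> Pow I"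
    then have "measure cube (DT K \<union> DU K) \<le> measure cube (DT K) + measure cube (DU K)"
      using D_sets by (intro measure_Un_le) auto
    also have "\<dots> \<le> 2 * \<delta>"
      using T(2)[of K] U(2)[of K] \<open>K \<in> Pow I\<close> unfolding DT_def DU_def by simp
    finally show "measure cube (DT K \<union> DU K) \<le> 2 * \<delta>" .
  qed
  also have "\<dots> = \<eta>" using cardP by (simp add: \<delta>_def field_simps)
  finally have E: "measure cube E \<le> \<eta>" .
  have close: "measure cube A \<le> measure cube B + \<eta>"
    if "A \<subseteq> B \<union> E" "B \<in> sets cube" for A B
  proof -
    have "measure cube A \<le> measure cube (B \<union> E)"
      using that E_sets by (intro cube.finite_measure_mono) auto
    also have "\<dots> \<le> measure cube B + measure cube E"
      using that E_sets by (intro measure_Un_le) auto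
    finally show ?thesis using E by simp
  qed
  let ?X = "\<Union>K\<in>Pow I. T K \<inter> U (I - K)" and ?T = "\<Union>K\<in>Pow I. T K" and ?U = "\<Union>K\<in>Pow I. U K"
  let ?F = "\<Union>K\<in>Pow I. F K" and ?G = "\<Union>K\<in>Pow I. G K"
  have sub: "?T \<subseteq> grid k" "?U \<subseteq> grid k" "?X \<subseteq> grid k"
    using cylinder_subset[OF T(1)] cylinder_subset[OF U(1)] by blast+
  have FG_sets: "?F \<in> sets cube" "?G \<in> sets cube"
    using F(1) G(1) finite_I by (auto intro!: sets.finite_UN)
  have in_E: "x \<in> E" if "K \<subseteq> I" "x \<in> DT K \<or> x \<in> DU K" for x K
    using that by (auto simp: E_def)
  have 1: "measure cube (\<Union>K\<in>Pow I. F K \<inter> G (I - K)) \<le> measure cube (grid_set k ?X) + \<eta>"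
  proof (rule close)
    show "(\<Union>K\<in>Pow I. F K \<inter> G (I - K)) \<subseteq> grid_set k ?X \<union> E"
    proof
      fix x assume "x \<in> (\<Union>K\<in>Pow I. F K \<inter> G (I - K))"
      then obtain K where K: "K \<subseteq> I" "x \<in> F K" "x \<in> G (I - K)" by blast
      show "x \<in> grid_set k ?X \<union> E"
      proof (cases "x \<in> grid_set k (T K) \<and> x \<in> grid_set k (U (I - K))")
        case True
        then show ?thesis using K(1) by (auto simp: grid_set_def)
      next
        case False
        then have "x \<in> DT K \<or> x \<in> DU (I - K)" using K by (auto simp: DT_def DU_def)
        then show ?thesis using in_E[of K x] in_E[of "I - K" x] K(1) by auto
      qed
    qed
  qed (rule grid_set(1)[OF sub(3)])
  have 2: "measure cube (grid_set k ?T) \<le> measure cube ?F + \<eta>"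
  proof (rule close[OF _ FG_sets(1)])
    have "x \<in> ?F \<union> E" if "K \<subseteq> I" "x \<in> grid_set k (T K)" for x K
      using that in_E[of K x] by (cases "x \<in> F K") (auto simp: DT_def)
    then show "grid_set k ?T \<subseteq> ?F \<union> E" unfolding grid_set_UN by blast
  qed
  have 3: "measure cube (grid_set k ?U) \<le> measure cube ?G + \<eta>"
  proof (rule close[OF _ FG_sets(2)])
    have "x \<in> ?G \<union> E" if "K \<subseteq> I" "x \<in> grid_set k (U K)" for x K
      using that in_E[of K x] by (cases "x \<in> G K") (auto simp: DU_def)
    then show "grid_set k ?U \<subseteq> ?G \<union> E" unfolding grid_set_UN by blast
  qed
  have "measure cube (grid_set k ?X) \<le> measure cube (grid_set k ?T) * measure cube (grid_set k ?U)"
  proof -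
    let ?n = "real (card (grid k))"
    have n: "?n > 0" unfolding card_grid by simp
    have "real (card ?X * card (grid k)) \<le> real (card ?T * card ?U)"
      using reimer_grid_cylinder[OF finite_I T(1) U(1)] by (simp only: of_nat_le_iff)
    then show ?thesis
      unfolding grid_set(2)[OF sub(1)] grid_set(2)[OF sub(2)] grid_set(2)[OF sub(3)]
      using n by (simp add: field_simps)
  qed
  also have "\<dots> \<le> (measure cube ?F + \<eta>) * (measure cube ?G + \<eta>)"
    using 2 3 \<eta> by (intro mult_mono) auto
  finally show ?thesis using 1 by linarith
qed

lemma bkr_cube:
  assumes F: "\<And>K. K \<subseteq> I \<Longrightarrow> F K \<in> sets cube" "\<And>K. K \<subseteq> I \<Longrightarrow> cylinder (space cube) K (F K)"
    and G: "\<And>K. K \<subseteq> I \<Longrightarrow> G K \<in> sets cube" "\<And>K. K \<subseteq> I \<Longrightarrow> cylinder (space cube) K (G K)"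
  shows "measure cube (\<Union>K\<in>Pow I. F K \<inter> G (I - K)) \<le>
    measure cube (\<Union>K\<in>Pow I. F K) * measure cube (\<Union>K\<in>Pow I. G K)"
    (is "?a \<le> ?b * ?c")
proof (rule tendsto_lowerbound)
  show "((\<lambda>\<eta>. (?b + \<eta>) * (?c + \<eta>) + \<eta>) \<longlongrightarrow> ?b * ?c) (at_right 0)"
    by (auto intro!: tendsto_eq_intros)
  show "\<forall>\<^sub>F \<eta> in at_right 0. ?a \<le> (?b + \<eta>) * (?c + \<eta>) + \<eta>"
    using bkr_cube_approx[OF F G] by (auto simp: eventually_at_filter)
qed simp

end

text \<open>The transport \<open>Q\<close> applies a quantile function in each coordinate
  separately, so preimages of cylinders over \<open>K\<close> are again cylinders over
  \<open>K\<close>, and the bound on the cube carries over.\<close>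

theorem bkr_measurable_cylinders:
  fixes \<mu> :: "'i \<Rightarrow> real measure"
  assumes I: "finite I" and \<mu>: "\<And>i. i \<in> I \<Longrightarrow> prob_space (\<mu> i)" "\<And>i. i \<in> I \<Longrightarrow> sets (\<mu> i) = sets borel"
  defines "P \<equiv> Pi\<^sub>M I \<mu>"
  assumes F: "\<And>K. K \<subseteq> I \<Longrightarrow> F K \<in> sets P" "\<And>K. K \<subseteq> I \<Longrightarrow> cylinder (space P) K (F K)"
    and G: "\<And>K. K \<subseteq> I \<Longrightarrow> G K \<in> sets P" "\<And>K. K \<subseteq> I \<Longrightarrow> cylinder (space P) K (G K)"
  shows "measure P (\<Union>K\<in>Pow I. F K \<inter> G (I - K)) \<le>
    measure P (\<Union>K\<in>Pow I. F K) * measure P (\<Union>K\<in>Pow I. G K)"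
proof -
  let ?cube = "Pi\<^sub>M I (\<lambda>_. unit_lebesgue)"
  \<comment> \<open>A point mass off \<open>I\<close> gives every index a probability measure and
    leaves the product over \<open>I\<close> unchanged.\<close>
  define \<nu> where "\<nu> i = (if i \<in> I then \<mu> i else return borel 0)" for i
  have \<nu>: "prob_space (\<nu> i)" "sets (\<nu> i) = sets borel" for i
    using \<mu> by (auto simp: \<nu>_def prob_space_return)
  have P: "P = Pi\<^sub>M I \<nu>" unfolding P_def \<nu>_def by (rule PiM_cong) auto
  have "\<exists>q\<in>borel_measurable unit_lebesgue. distr unit_lebesgue borel q = \<nu> i" for i
    by (rule ex_quantile_function[OF \<nu>])
  then obtain q where q: "\<And>i. q i \<in> borel_measurable unit_lebesgue" "\<And>i. distr unit_lebesgue borel (q i) = \<nu> i"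
    by metis
  define Q where "Q \<omega> = (\<lambda>i\<in>I. q i (\<omega> i))" for \<omega>
  have q\<nu>: "q i \<in> unit_lebesgue \<rightarrow>\<^sub>M \<nu> i" for i using q(1)[of i] \<nu>(2)[of i] by (simp cong: measurable_cong_sets)
  have Q_meas: "Q \<in> ?cube \<rightarrow>\<^sub>M P"
    unfolding Q_def P
    by (intro measurable_restrict measurable_compose[OF _ q\<nu>] measurable_component_singleton)
  interpret U: prob_space unit_lebesgue by (rule prob_space_unit_lebesgue)
  interpret cube: product_sigma_finite "\<lambda>_::'i. unit_lebesgue" ..
  interpret \<nu>: product_prob_space \<nu> by (rule product_prob_spaceI) (rule \<nu>)
  have distr_Q: "distr ?cube P Q = P"
    unfolding P
  proof (rule \<nu>.PiM_eqI[OF I])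
    fix A assume A: "\<And>i. i \<in> I \<Longrightarrow> A i \<in> sets (\<nu> i)"
    have A_box: "Pi\<^sub>E I A \<in> sets (Pi\<^sub>M I \<nu>)" using A I by (intro sets_PiM_I_finite)
    have "emeasure (distr ?cube (Pi\<^sub>M I \<nu>) Q) (Pi\<^sub>E I A) = emeasure ?cube (Q -` Pi\<^sub>E I A \<inter> space ?cube)"
      using Q_meas A_box unfolding P by (rule emeasure_distr)
    also have "Q -` Pi\<^sub>E I A \<inter> space ?cube = (\<Pi>\<^sub>E i\<in>I. q i -` A i \<inter> space unit_lebesgue)"
      by (auto simp: Q_def space_PiM PiE_iff)
    also have "emeasure ?cube \<dots> = (\<Prod>i\<in>I. emeasure unit_lebesgue (q i -` A i \<inter> space unit_lebesgue))"
      using A measurable_sets[OF q\<nu>] by (intro cube.emeasure_PiM[OF I]) auto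
    also have "\<dots> = (\<Prod>i\<in>I. emeasure (distr unit_lebesgue borel (q i)) (A i))"
      using A q(1) \<nu>(2) by (intro prod.cong refl emeasure_distr[symmetric]) auto
    finally show "emeasure (distr ?cube (Pi\<^sub>M I \<nu>) Q) (Pi\<^sub>E I A) = (\<Prod>i\<in>I. emeasure (\<nu> i) (A i))"
      by (simp add: q(2))
  qed simp
  have measure_Q: "measure P A = measure ?cube (Q -` A \<inter> space ?cube)" if "A \<in> sets P" for A
    using measure_distr[OF Q_meas that] by (simp add: distr_Q)
  have Q_space: "Q \<omega> \<in> space P" if "\<omega> \<in> space ?cube" for \<omega>
    using measurable_space[OF Q_meas that] .
  have pull: "Q -` A \<inter> space ?cube \<in> sets ?cube" if "A \<in> sets P" for A
    using measurable_sets[OF Q_meas that] .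
  have pull_cyl: "cylinder (space ?cube) K (Q -` A \<inter> space ?cube)"
    if A: "cylinder (space P) K A" for K A
    unfolding cylinder_def
  proof (intro conjI ballI impI)
    fix x y assume x: "x \<in> Q -` A \<inter> space ?cube" and y: "y \<in> space ?cube" "\<forall>i\<in>K. y i = x i"
    have "Q y \<in> A"
    proof (rule cylinderD[OF A, of "Q x"])
      show "Q y i = Q x i" if "i \<in> K" for i using y(2) that by (simp add: Q_def restrict_def)
    qed (use x Q_space[OF y(1)] in auto)
    then show "y \<in> Q -` A \<inter> space ?cube" using y by simp
  qed simp
  define F' where "F' K = Q -` F K \<inter> space ?cube" for K
  define G' where "G' K = Q -` G K \<inter> space ?cube" for K
  have "measure P (\<Union>K\<in>Pow I. F K \<inter> G (I - K)) = measure ?cube (\<Union>K\<in>Pow I. F' K \<inter> G' (I - K))"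
    using F(1) G(1) I
    by (subst measure_Q) (auto simp: F'_def G'_def intro!: sets.finite_UN arg_cong[where f = "measure ?cube"])
  also have "\<dots> \<le> measure ?cube (\<Union>K\<in>Pow I. F' K) * measure ?cube (\<Union>K\<in>Pow I. G' K)"
    unfolding F'_def G'_def by (rule bkr_cube[OF I pull[OF F(1)] pull_cyl[OF F(2)] pull[OF G(1)] pull_cyl[OF G(2)]])
  also have "measure ?cube (\<Union>K\<in>Pow I. F' K) = measure P (\<Union>K\<in>Pow I. F K)"
    using F(1) I by (subst measure_Q) (auto simp: F'_def intro!: sets.finite_UN arg_cong[where f = "measure ?cube"])
  also have "measure ?cube (\<Union>K\<in>Pow I. G' K) = measure P (\<Union>K\<in>Pow I. G K)"
    using G(1) I by (subst measure_Q) (auto simp: G'_def intro!: sets.finite_UN arg_cong[where f = "measure ?cube"])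
  finally show ?thesis .
qed

section \<open>The box operators\<close>

text \<open>
  The operator for families of cylinder-like sets \<open>F i K\<close> rather than for events: \<open>F i K\<close> plays the role of
  \<open>[A\<^sub>i]\<^sub>K\<close>, and can be replaced by a Borel set that differs from it by a null set, which would not be possible
  for the events themselves.
\<close>

primrec disjoint_occurrence ::
  "'a set \<Rightarrow> (nat \<Rightarrow> 'i set \<Rightarrow> 'a set) \<Rightarrow> nat \<Rightarrow> 'i set \<Rightarrow> 'a set" where
  "disjoint_occurrence \<Omega> F 0 L = \<Omega>"
| "disjoint_occurrence \<Omega> F (Suc r) L =
     (\<Union>(J, K)\<in>{(J, K). J \<subseteq> L \<and> K \<subseteq> L \<and> J \<inter> K = {}}. disjoint_occurrence \<Omega> F r J \<inter> F (Suc r) K)"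

text \<open>The recursion isolates the last event, as the induction requires, while the box operator
  speaks of tuples. The coordinate set handed to the earlier events can be taken as the complement
  in \<open>L\<close> of the last set.\<close>

lemma in_disjoint_occurrence_iff:
  "\<omega> \<in> disjoint_occurrence \<Omega> F r L \<longleftrightarrow>
     \<omega> \<in> \<Omega> \<and> (\<exists>J. disjoint_family_on J {1..r} \<and> (\<forall>i\<in>{1..r}. J i \<subseteq> L \<and> \<omega> \<in> F i (J i)))"
proof (induction r arbitrary: L)
  case 0
  show ?case by (simp add: disjoint_family_on_def)
next
  case (Suc r)
  show ?case
  proof
    assume "\<omega> \<in> disjoint_occurrence \<Omega> F (Suc r) L"
    then obtain M K where MK: "M \<subseteq> L" "K \<subseteq> L" "M \<inter> K = {}"
        "\<omega> \<in> disjoint_occurrence \<Omega> F r M" "\<omega> \<in> F (Suc r) K" by auto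
    from MK(4)[unfolded Suc.IH] obtain J where \<omega>: "\<omega> \<in> \<Omega>" and
      J: "disjoint_family_on J {1..r}" "\<And>i. i \<in> {1..r} \<Longrightarrow> J i \<subseteq> M" "\<And>i. i \<in> {1..r} \<Longrightarrow> \<omega> \<in> F i (J i)"
      by blast
    have eq: "(J(Suc r := K)) i = (if i = Suc r then K else J i)" for i by simp
    have split: "i \<in> {1..Suc r} \<longleftrightarrow> i = Suc r \<or> i \<in> {1..r}" for i by auto
    have "disjoint_family_on (J(Suc r := K)) {1..Suc r}"
      unfolding disjoint_family_on_def eq split
    proof (intro ballI impI)
      fix m n assume "m \<in> {1..Suc r}" "n \<in> {1..Suc r}" "m \<noteq> n"
      then consider "m = Suc r" "n \<in> {1..r}" | "n = Suc r" "m \<in> {1..r}" | "m \<in> {1..r}" "n \<in> {1..r}"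
        unfolding split by blast
      then show "(if m = Suc r then K else J m) \<inter> (if n = Suc r then K else J n) = {}"
      proof cases
        case 1 then show ?thesis using J(2)[of n] MK(3) \<open>m \<noteq> n\<close> by auto
      next
        case 2 then show ?thesis using J(2)[of m] MK(3) \<open>m \<noteq> n\<close> by auto
      next
        case 3 then show ?thesis using disjoint_family_onD[OF J(1) 3 \<open>m \<noteq> n\<close>] by auto
      qed
    qed
    moreover have "(J(Suc r := K)) i \<subseteq> L \<and> \<omega> \<in> F i ((J(Suc r := K)) i)" if "i \<in> {1..Suc r}" for i
      using that[unfolded split] J(2,3)[of i] MK unfolding eq by auto
    ultimately show "\<omega> \<in> \<Omega> \<and> (\<exists>J. disjoint_family_on J {1..Suc r} \<and> (\<forall>i\<in>{1..Suc r}. J i \<subseteq> L \<and> \<omega> \<in> F i (J i)))"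
      using \<omega> by (intro conjI exI[of _ "J(Suc r := K)"]) simp_all
  next
    assume "\<omega> \<in> \<Omega> \<and> (\<exists>J. disjoint_family_on J {1..Suc r} \<and> (\<forall>i\<in>{1..Suc r}. J i \<subseteq> L \<and> \<omega> \<in> F i (J i)))"
    then obtain J where \<omega>: "\<omega> \<in> \<Omega>" and J: "disjoint_family_on J {1..Suc r}"
        "\<And>i. i \<in> {1..Suc r} \<Longrightarrow> J i \<subseteq> L" "\<And>i. i \<in> {1..Suc r} \<Longrightarrow> \<omega> \<in> F i (J i)" by blast
    have "J i \<subseteq> L - J (Suc r)" if "i \<in> {1..r}" for i
      using J(2)[of i] disjoint_family_onD[OF J(1), of i "Suc r"] that by fastforce
    moreover have "disjoint_family_on J {1..r}"
      by (rule disjoint_family_on_mono[OF _ J(1)]) auto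
    ultimately have "\<omega> \<in> disjoint_occurrence \<Omega> F r (L - J (Suc r))"
      unfolding Suc.IH using \<omega> J(3) by (intro conjI exI[of _ J]) auto
    moreover have "J (Suc r) \<subseteq> L" "\<omega> \<in> F (Suc r) (J (Suc r))" using J by auto
    ultimately show "\<omega> \<in> disjoint_occurrence \<Omega> F (Suc r) L"
      unfolding disjoint_occurrence.simps
      by (intro UN_I[of "(L - J (Suc r), J (Suc r))"]) auto
  qed
qed

lemma disjoint_occurrence_mono:
  assumes "L \<subseteq> L'"
  shows "disjoint_occurrence \<Omega> F r L \<subseteq> disjoint_occurrence \<Omega> F r L'"
proof
  fix \<omega> assume "\<omega> \<in> disjoint_occurrence \<Omega> F r L"
  then show "\<omega> \<in> disjoint_occurrence \<Omega> F r L'"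
    unfolding in_disjoint_occurrence_iff using assms by (elim conjE exE) (intro conjI exI, auto)
qed

text \<open>For \<open>r = 0\<close> the intersection in \<open>BKR_family\<close> is the whole type
  while the recursion gives \<open>Rd d\<close>; a single event already confines the points to
  \<open>Rd d\<close>.\<close>

lemma BKR_family_eq_disjoint_occurrence:
  assumes "r \<ge> 1"
  shows "BKR_family d r A = disjoint_occurrence (Rd d) (\<lambda>i. cyl_core d (A i)) r {1..d}"
proof (intro set_eqI)
  fix \<omega>
  have "\<omega> \<in> BKR_family d r A \<longleftrightarrow>
      (\<exists>J. disjoint_family_on J {1..r} \<and> (\<forall>i\<in>{1..r}. J i \<subseteq> {1..d} \<and> \<omega> \<in> cyl_core d (A i) (J i)))"
    unfolding BKR_family_def by (auto simp: Pi_iff)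
  moreover have "\<omega> \<in> Rd d" if "\<omega> \<in> cyl_core d (A 1) K" for K
    using that by (simp add: cyl_core_def)
  ultimately show "\<omega> \<in> BKR_family d r A \<longleftrightarrow> \<omega> \<in> disjoint_occurrence (Rd d) (\<lambda>i. cyl_core d (A i)) r {1..d}"
    unfolding in_disjoint_occurrence_iff using assms by fastforce
qed

lemma BKR_eq_BKR_family: "BKR d A B = BKR_family d 2 (\<lambda>i. if i = 1 then A else B)"
proof -
  have two: "{1..2} = {1, 2 :: nat}" by auto
  have "\<omega> \<in> BKR d A B \<longleftrightarrow> \<omega> \<in> BKR_family d 2 (\<lambda>i. if i = 1 then A else B)" for \<omega>
  proof
    assume "\<omega> \<in> BKR d A B"
    then obtain J K where JK: "J \<subseteq> {1..d}" "K \<subseteq> {1..d}" "J \<inter> K = {}"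
        "\<omega> \<in> cyl_core d A J" "\<omega> \<in> cyl_core d B K"
      unfolding BKR_eq_disjoint_pairs by auto
    then show "\<omega> \<in> BKR_family d 2 (\<lambda>i. if i = 1 then A else B)"
      unfolding BKR_family_def two
      by (intro UN_I[of "\<lambda>i. if i = 1 then J else K"]) (auto simp: disjoint_family_on_def)
  next
    assume "\<omega> \<in> BKR_family d 2 (\<lambda>i. if i = 1 then A else B)"
    then obtain J :: "nat \<Rightarrow> nat set" where "J 1 \<subseteq> {1..d}" "J 2 \<subseteq> {1..d}" "J 1 \<inter> J 2 = {}"
        "\<omega> \<in> cyl_core d A (J 1)" "\<omega> \<in> cyl_core d B (J 2)"
      unfolding BKR_family_def two by (auto simp: disjoint_family_on_def Pi_iff)
    then show "\<omega> \<in> BKR d A B"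
      unfolding BKR_eq_disjoint_pairs by (intro UN_I[of "(J 1, J 2)"]) auto
  qed
  then show ?thesis by blast
qed

section \<open>Induction on the number of events\<close>

lemma disjoint_occurrence_measurable_cylinder:
  assumes L: "finite L" "L \<subseteq> I"
    and F: "\<And>i K. i \<in> {1..r} \<Longrightarrow> K \<subseteq> I \<Longrightarrow> F i K \<in> sets M"
           "\<And>i K. i \<in> {1..r} \<Longrightarrow> K \<subseteq> I \<Longrightarrow> cylinder (space M) K (F i K)"
  shows "disjoint_occurrence (space M) F r L \<in> sets M \<and>
    cylinder (space M) L (disjoint_occurrence (space M) F r L)"
  using assms
proof (induction r arbitrary: L)
  case 0
  then show ?case by (simp add: cylinder_def)
next
  case (Suc r)
  let ?S = "{(J, K). J \<subseteq> L \<and> K \<subseteq> L \<and> J \<inter> K = {}}"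
  have "finite ?S"
    by (rule finite_subset[of _ "Pow L \<times> Pow L"]) (use Suc.prems in auto)
  moreover have step: "disjoint_occurrence (space M) F r J \<inter> F (Suc r) K \<in> sets M"
    "cylinder (space M) L (disjoint_occurrence (space M) F r J \<inter> F (Suc r) K)"
    if "(J, K) \<in> ?S" for J K
  proof -
    have JK: "finite J" "J \<subseteq> I" "J \<subseteq> L" "K \<subseteq> I" "K \<subseteq> L"
      using that Suc.prems(1,2) finite_subset by auto
    have IH: "disjoint_occurrence (space M) F r J \<in> sets M"
        "cylinder (space M) J (disjoint_occurrence (space M) F r J)"
      using Suc.IH[OF JK(1,2)] Suc.prems(3,4) by auto
    show "disjoint_occurrence (space M) F r J \<inter> F (Suc r) K \<in> sets M"
      using IH(1) Suc.prems(3)[OF _ JK(4)] by auto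
    show "cylinder (space M) L (disjoint_occurrence (space M) F r J \<inter> F (Suc r) K)"
      using cylinder_mono[OF IH(2) JK(3)] cylinder_mono[OF Suc.prems(4)[OF _ JK(4)] JK(5), of "Suc r"]
      by (intro cylinder_Int) auto
  qed
  ultimately show ?case
    unfolding disjoint_occurrence.simps
    by (intro conjI sets.finite_UN cylinder_UN) (simp_all only: split_paired_all case_prod_conv)
qed

text \<open>The first \<open>r\<close> events act as a single family \<open>?H\<close>, indexed by
  the coordinates they may use; its members are measurable cylinders, so the bound for two families
  applies to it and the last family.\<close>

theorem disjoint_occurrence_measure_le:
  fixes \<mu> :: "'i \<Rightarrow> real measure"
  assumes I: "finite I" and \<mu>: "\<And>i. i \<in> I \<Longrightarrow> prob_space (\<mu> i)" "\<And>i. i \<in> I \<Longrightarrow> sets (\<mu> i) = sets borel"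
  defines "P \<equiv> Pi\<^sub>M I \<mu>"
  assumes F: "\<And>i K. i \<in> {1..r} \<Longrightarrow> K \<subseteq> I \<Longrightarrow> F i K \<in> sets P"
             "\<And>i K. i \<in> {1..r} \<Longrightarrow> K \<subseteq> I \<Longrightarrow> cylinder (space P) K (F i K)"
  shows "measure P (disjoint_occurrence (space P) F r I) \<le> (\<Prod>i\<in>{1..r}. measure P (\<Union>K\<in>Pow I. F i K))"
  using F
proof (induction r)
  case 0
  interpret prob_space P unfolding P_def by (rule prob_space_PiM) (rule \<mu>(1))
  show ?case by (simp add: prob_space)
next
  case (Suc r)
  interpret prob_space P unfolding P_def by (rule prob_space_PiM) (rule \<mu>(1))
  let ?H = "disjoint_occurrence (space P) F r" and ?G = "F (Suc r)"
  have H: "?H K \<in> sets P" "cylinder (space P) K (?H K)" if "K \<subseteq> I" for K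
    using disjoint_occurrence_measurable_cylinder[OF finite_subset[OF that I] that, of r F P] Suc.prems
    by auto
  have G: "?G K \<in> sets P" "cylinder (space P) K (?G K)" if "K \<subseteq> I" for K
    using Suc.prems that by auto
  have "disjoint_occurrence (space P) F (Suc r) I \<subseteq> (\<Union>K\<in>Pow I. ?H K \<inter> ?G (I - K))"
  proof
    fix \<omega> assume "\<omega> \<in> disjoint_occurrence (space P) F (Suc r) I"
    then obtain J K where JK: "J \<subseteq> I" "K \<subseteq> I" "J \<inter> K = {}" "\<omega> \<in> ?H J" "\<omega> \<in> ?G K"
      by auto
    have "J \<subseteq> I - K" using JK by blast
    from subsetD[OF disjoint_occurrence_mono[OF this] JK(4)] have "\<omega> \<in> ?H (I - K)" .
    moreover have "I - (I - K) = K" using JK(2) by blast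
    ultimately show "\<omega> \<in> (\<Union>K\<in>Pow I. ?H K \<inter> ?G (I - K))"
      using JK(5) by (intro UN_I[of "I - K"]) auto
  qed
  moreover have "(\<Union>K\<in>Pow I. ?H K \<inter> ?G (I - K)) \<in> sets P"
    using H G I by (intro sets.finite_UN) auto
  ultimately have "measure P (disjoint_occurrence (space P) F (Suc r) I) \<le>
      measure P (\<Union>K\<in>Pow I. ?H K \<inter> ?G (I - K))"
    by (rule finite_measure_mono)
  also have "\<dots> \<le> measure P (\<Union>K\<in>Pow I. ?H K) * measure P (\<Union>K\<in>Pow I. ?G K)"
    using H G unfolding P_def by (intro bkr_measurable_cylinders[OF I \<mu>])
  \<comment> \<open>\<open>?H\<close> grows with its index set, so the union is its largest member,
    which the induction hypothesis bounds.\<close>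
  also have "(\<Union>K\<in>Pow I. ?H K) = ?H I"
  proof
    show "(\<Union>K\<in>Pow I. ?H K) \<subseteq> ?H I"
      by (rule UN_least) (rule disjoint_occurrence_mono, simp)
    show "?H I \<subseteq> (\<Union>K\<in>Pow I. ?H K)"
      by (rule UN_upper) simp
  qed
  also have "measure P (?H I) * measure P (\<Union>K\<in>Pow I. ?G K) \<le>
      (\<Prod>i\<in>{1..r}. measure P (\<Union>K\<in>Pow I. F i K)) * measure P (\<Union>K\<in>Pow I. ?G K)"
    by (intro mult_right_mono Suc.IH Suc.prems measure_nonneg) auto
  also have "\<dots> = (\<Prod>i\<in>{1..Suc r}. measure P (\<Union>K\<in>Pow I. F i K))"
    by (simp add: mult.commute)
  finally show ?case .
qed

section \<open>Borel replacements for the cylinder cores\<close>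

lemma cyl_core_eq_restrict_notin:
  "cyl_core d A K = {\<omega> \<in> Rd d. restrict \<omega> K \<notin> (\<lambda>x. restrict x K) ` (Rd d - A)}"
proof -
  have "Cyl d K \<omega> \<subseteq> A \<longleftrightarrow> restrict \<omega> K \<notin> (\<lambda>x. restrict x K) ` (Rd d - A)" for \<omega>
  proof -
    have eq: "restrict \<omega> K = restrict x K \<longleftrightarrow> (\<forall>i\<in>K. x i = \<omega> i)" for x :: "nat \<Rightarrow> real"
    proof
      assume "restrict \<omega> K = restrict x K"
      then show "\<forall>i\<in>K. x i = \<omega> i" by (metis restrict_apply')
    qed (auto intro: restrict_ext)
    show ?thesis unfolding Cyl_def image_iff eq by blast
  qed
  then show ?thesis unfolding cyl_core_def by simp
qed

text \<open>The gap is found in the product over \<open>K\<close> and pulled back. Restriction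
  preserves the measure, so the null set stays null, and a set pulled back along it is a cylinder
  over \<open>K\<close>.\<close>

lemma cyl_core_null_gap:
  fixes \<mu> :: "nat \<Rightarrow> real measure"
  assumes \<mu>: "\<And>i. prob_space (\<mu> i)" "\<And>i. sets (\<mu> i) = sets borel"
    and A: "A \<in> borel_sets d" and K: "K \<subseteq> {1..d}"
  defines "P \<equiv> Pi\<^sub>M {1..d} \<mu>"
  shows "\<exists>Z\<in>sets P. \<exists>N\<in>null_sets P. cylinder (Rd d) K Z \<and> Z \<subseteq> cyl_core d A K \<and> cyl_core d A K \<subseteq> Z \<union> N"
proof -
  interpret product_prob_space \<mu> "{1..d}" by (rule product_prob_spaceI) (rule \<mu>)
  let ?M = "Pi\<^sub>M K \<mu>" and ?h = "\<lambda>x :: nat \<Rightarrow> real. restrict x K"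
  have space_\<mu>: "space (\<mu> i) = UNIV" for i using sets_eq_imp_space_eq[OF \<mu>(2)] by simp
  have space: "space P = Rd d" "space ?M = K \<rightarrow>\<^sub>E UNIV" by (simp_all add: P_def space_PiM space_\<mu> Rd_def)
  have finK: "finite K" using K finite_subset by blast
  have "Rd d - A \<in> sets (Pi\<^sub>M {1..d} (\<lambda>_. borel :: real measure))"
  proof -
    have "Rd d = space (Pi\<^sub>M {1..d} (\<lambda>_. borel :: real measure))" by (simp add: space_PiM Rd_def)
    then show ?thesis using A by (auto simp: borel_sets_eq_PiM)
  qed
  from restrict_image_null_gap[where M = \<mu> and K = K, OF \<mu> finite_atLeastAtMost this] obtain Z N where
    ZN: "Z \<in> sets ?M" "N \<in> null_sets ?M" "Z \<subseteq> ?h ` (Rd d - A)" "?h ` (Rd d - A) \<subseteq> Z \<union> N"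
    by (elim bexE conjE)
  have h: "?h \<in> P \<rightarrow>\<^sub>M ?M" unfolding P_def by (rule measurable_restrict_subset[OF K])
  \<comment> \<open>Removing \<open>N\<close> along with \<open>Z\<close> makes \<open>W\<close>
    miss the whole projection of the complement, so its preimage lies inside
    \<open>cyl_core d A K\<close>; the loss is contained in the preimage of
    \<open>N\<close>.\<close>
  define W where "W = space ?M - (Z \<union> N)"
  have W: "W \<in> sets ?M" using ZN by (auto simp: W_def)
  define Z' where "Z' = ?h -` W \<inter> space P"
  define N' where "N' = ?h -` N \<inter> space P"
  have "Z' \<in> sets P" unfolding Z'_def by (rule measurable_sets[OF h W])
  moreover have "N' \<in> null_sets P"
  proof -
    have N: "N \<in> sets ?M" "emeasure ?M N = 0" using ZN(2) by auto
    have "emeasure P N' = emeasure (distr P ?M ?h) N"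
      unfolding N'_def by (rule emeasure_distr[symmetric, OF h N(1)])
    also have "\<dots> = 0" using distr_PiM_restrict_finite[OF finK K] N(2) by (simp add: P_def)
    finally show ?thesis using measurable_sets[OF h N(1)] by (auto simp: N'_def)
  qed
  moreover have "cylinder (Rd d) K Z'"
    unfolding cylinder_def
  proof (intro conjI ballI impI)
    fix x y assume "x \<in> Z'" "y \<in> Rd d" "\<forall>i\<in>K. y i = x i"
    moreover from this have "?h y = ?h x" by (intro restrict_ext) simp
    ultimately show "y \<in> Z'" unfolding Z'_def space by simp
  qed (auto simp: Z'_def space)
  moreover have "Z' \<subseteq> cyl_core d A K"
    unfolding cyl_core_eq_restrict_notin Z'_def W_def space using ZN(4) by blast
  moreover have "cyl_core d A K \<subseteq> Z' \<union> N'"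
  proof
    fix \<omega> assume "\<omega> \<in> cyl_core d A K"
    then have \<omega>: "\<omega> \<in> Rd d" "?h \<omega> \<notin> ?h ` (Rd d - A)" by (auto simp: cyl_core_eq_restrict_notin)
    then have "?h \<omega> \<notin> Z" using ZN(3) by blast
    moreover have "?h \<omega> \<in> space ?M" unfolding space by simp
    ultimately show "\<omega> \<in> Z' \<union> N'" using \<omega>(1) unfolding Z'_def N'_def W_def space(1) by blast
  qed
  ultimately show ?thesis by (intro bexI[of _ Z'] bexI[of _ N'] conjI)
qed

text \<open>The comparison is made at the single point \<open>\<omega>\<close>, so it serves both
  for inclusions and for points outside a null set.\<close>

lemma disjoint_occurrence_cong:
  assumes "\<And>i K. i \<in> {1..r} \<Longrightarrow> K \<subseteq> L \<Longrightarrow> \<omega> \<in> F i K \<Longrightarrow> \<omega> \<in> G i K"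
    and "\<omega> \<in> disjoint_occurrence \<Omega> F r L"
  shows "\<omega> \<in> disjoint_occurrence \<Omega> G r L"
proof -
  from assms(2) obtain J where "\<omega> \<in> \<Omega>" "disjoint_family_on J {1..r}"
      "\<forall>i\<in>{1..r}. J i \<subseteq> L \<and> \<omega> \<in> F i (J i)"
    unfolding in_disjoint_occurrence_iff by blast
  then show ?thesis
    unfolding in_disjoint_occurrence_iff using assms(1) by (intro conjI exI[of _ J]) auto
qed

text \<open>Only finitely many pairs of an event and a coordinate set occur, so one null set
  \<open>N0\<close> accounts for all replacements. The box \<open>?B\<close> lies between
  \<open>?B'\<close> and \<open>?B' \<union> N0\<close>, hence belongs to the completion and has the
  measure of \<open>?B'\<close>.\<close>

lemma BKR_family_measure_le:
  assumes P: "complete_product_prob d P" and r: "r \<ge> 1"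
    and A: "\<And>i. i \<in> {1..r} \<Longrightarrow> A i \<in> borel_sets d"
  shows "BKR_family d r A \<in> sets P \<and> measure P (BKR_family d r A) \<le> (\<Prod>i\<in>{1..r}. measure P (A i))"
proof -
  let ?I = "{1..d}"
  from P obtain \<nu> :: "nat \<Rightarrow> real measure" where
    \<nu>: "\<And>i. i \<in> ?I \<Longrightarrow> prob_space (\<nu> i)" "\<And>i. i \<in> ?I \<Longrightarrow> sets (\<nu> i) = sets borel"
      "P = completion (Pi\<^sub>M ?I \<nu>)"
    unfolding complete_product_prob_def by blast
  define \<mu> where "\<mu> i = (if i \<in> ?I then \<nu> i else return borel 0)" for i
  have \<mu>: "prob_space (\<mu> i)" "sets (\<mu> i) = sets borel" for i
    using \<nu>(1,2) by (auto simp: \<mu>_def prob_space_return)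
  define Q where "Q = Pi\<^sub>M ?I \<mu>"
  have "Pi\<^sub>M ?I \<nu> = Q" unfolding Q_def \<mu>_def by (rule PiM_cong) auto
  then have PQ: "P = completion Q" using \<nu>(3) by simp
  interpret Q: prob_space Q unfolding Q_def by (rule prob_space_PiM) (rule \<mu>)
  have space_\<mu>: "space (\<mu> i) = UNIV" for i using sets_eq_imp_space_eq[OF \<mu>(2)] by simp
  have space: "space Q = Rd d" by (simp add: Q_def space_PiM space_\<mu> Rd_def)
  have "sets Q = borel_sets d"
    unfolding borel_sets_eq_PiM Q_def using \<mu>(2) by (intro sets_PiM_cong) auto
  then have A_sets: "A i \<in> sets Q" if "i \<in> {1..r}" for i using A that by simp
  let ?C = "\<lambda>i. cyl_core d (A i)"
  have "\<forall>p\<in>{1..r} \<times> Pow ?I. \<exists>ZN. fst ZN \<in> sets Q \<and> snd ZN \<in> null_sets Q \<and>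
      cylinder (Rd d) (snd p) (fst ZN) \<and> fst ZN \<subseteq> ?C (fst p) (snd p) \<and> ?C (fst p) (snd p) \<subseteq> fst ZN \<union> snd ZN"
  proof
    fix p assume p: "p \<in> {1..r} \<times> Pow ?I"
    then have "A (fst p) \<in> borel_sets d" "snd p \<subseteq> ?I" using A by auto
    from cyl_core_null_gap[where \<mu> = \<mu>, OF \<mu> this, folded Q_def] obtain Z N where
      "Z \<in> sets Q" "N \<in> null_sets Q" "cylinder (Rd d) (snd p) Z"
      "Z \<subseteq> ?C (fst p) (snd p)" "?C (fst p) (snd p) \<subseteq> Z \<union> N" by (elim bexE conjE)
    then show "\<exists>ZN. fst ZN \<in> sets Q \<and> snd ZN \<in> null_sets Q \<and>
      cylinder (Rd d) (snd p) (fst ZN) \<and> fst ZN \<subseteq> ?C (fst p) (snd p) \<and> ?C (fst p) (snd p) \<subseteq> fst ZN \<union> snd ZN"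
      by (intro exI[of _ "(Z, N)"]) simp
  qed
  from bchoice[OF this] obtain ZN where ZN: "\<forall>p\<in>{1..r} \<times> Pow ?I. fst (ZN p) \<in> sets Q \<and> snd (ZN p) \<in> null_sets Q \<and>
      cylinder (Rd d) (snd p) (fst (ZN p)) \<and> fst (ZN p) \<subseteq> ?C (fst p) (snd p) \<and>
      ?C (fst p) (snd p) \<subseteq> fst (ZN p) \<union> snd (ZN p)" ..
  define Z where "Z i K = fst (ZN (i, K))" for i K
  define N where "N i K = snd (ZN (i, K))" for i K
  have Z: "Z i K \<in> sets Q" "cylinder (space Q) K (Z i K)" "Z i K \<subseteq> ?C i K" "?C i K \<subseteq> Z i K \<union> N i K"
    and N: "N i K \<in> null_sets Q" if "i \<in> {1..r}" "K \<subseteq> ?I" for i K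
    using bspec[OF ZN, of "(i, K)"] that unfolding Z_def N_def space by simp_all
  define N0 where "N0 = (\<Union>p\<in>{1..r} \<times> Pow ?I. N (fst p) (snd p))"
  have N0: "N0 \<in> null_sets Q"
    unfolding N0_def
  proof (rule null_sets_UN')
    show "countable ({1..r} \<times> Pow ?I)" by (intro countable_finite) auto
    show "N (fst p) (snd p) \<in> null_sets Q" if "p \<in> {1..r} \<times> Pow ?I" for p
      using that by (intro N) (simp_all add: mem_Times_iff)
  qed
  let ?B = "disjoint_occurrence (Rd d) ?C r ?I" and ?B' = "disjoint_occurrence (Rd d) Z r ?I"
  have B'_sets: "?B' \<in> sets Q"
    using disjoint_occurrence_measurable_cylinder[OF finite_atLeastAtMost order_refl, where M = Q and F = Z and r = r] Z(1,2)
    by (simp add: space)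
  have B'_sub: "?B' \<subseteq> ?B"
    using disjoint_occurrence_cong[of r ?I _ Z ?C] Z(3) by blast
  have B_sub: "?B \<subseteq> ?B' \<union> N0"
  proof
    fix \<omega> assume \<omega>: "\<omega> \<in> ?B"
    show "\<omega> \<in> ?B' \<union> N0"
    proof (cases "\<omega> \<in> N0")
      case False
      have "\<omega> \<in> Z i K" if "i \<in> {1..r}" "K \<subseteq> ?I" "\<omega> \<in> ?C i K" for i K
      proof -
        have "(i, K) \<in> {1..r} \<times> Pow ?I" using that by simp
        then have "\<omega> \<notin> N i K" using False unfolding N0_def by force
        then show ?thesis using Z(4)[OF that(1,2)] that(3) by blast
      qed
      then show ?thesis using disjoint_occurrence_cong[OF _ \<omega>] by blast
    qed simp
  qed
  have B_sets: "?B \<in> sets P"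
    unfolding PQ using B'_sub B_sub
    by (intro sets_completionI[OF _ _ N0 B'_sets, of _ "?B - ?B'"]) blast+
  have "measure P ?B \<le> measure P (?B' \<union> N0)"
  proof -
    interpret P: prob_space P unfolding PQ by (rule Q.prob_space_completion)
    show ?thesis
      using B_sub B'_sets N0 by (intro P.finite_measure_mono) (auto simp: PQ)
  qed
  also have "\<dots> = measure Q (?B' \<union> N0)"
    unfolding PQ using B'_sets N0 by (intro measure_completion) auto
  also have "\<dots> = measure Q ?B'"
    using B'_sets N0 by (simp add: measure_Un_null_set)
  also have "\<dots> \<le> (\<Prod>i\<in>{1..r}. measure Q (\<Union>K\<in>Pow ?I. Z i K))"
    using disjoint_occurrence_measure_le[where \<mu> = \<mu> and F = Z and r = r, OF finite_atLeastAtMost[of 1 d] \<mu>] Z(1,2)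
    unfolding Q_def[symmetric] space by blast
  also have "\<dots> \<le> (\<Prod>i\<in>{1..r}. measure P (A i))"
  proof (intro prod_mono conjI measure_nonneg)
    fix i assume i: "i \<in> {1..r}"
    have "?C i K \<subseteq> A i" for K by (auto simp: cyl_core_def Cyl_def)
    then have "(\<Union>K\<in>Pow ?I. Z i K) \<subseteq> A i" using Z(3)[OF i] by blast
    then have "measure Q (\<Union>K\<in>Pow ?I. Z i K) \<le> measure Q (A i)"
      using A_sets[OF i] by (intro Q.finite_measure_mono)
    then show "measure Q (\<Union>K\<in>Pow ?I. Z i K) \<le> measure P (A i)"
      using A_sets[OF i] by (simp add: PQ)
  qed
  finally show ?thesis
    using B_sets unfolding BKR_family_eq_disjoint_occurrence[OF r] by blast
qed

theorem theorem6:
  fixes d :: nat and P :: "(nat \<Rightarrow> real) measure"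
  assumes "d \<ge> 1" and "complete_product_prob d P"
  shows "(\<forall>A\<in>borel_sets d. \<forall>B\<in>borel_sets d.
            BKR d A B \<in> sets P \<and> measure P (BKR d A B) \<le> measure P A * measure P B) \<and>
         (\<forall>r\<ge>2. \<forall>A :: nat \<Rightarrow> (nat \<Rightarrow> real) set. (\<forall>i\<in>{1..r}. A i \<in> borel_sets d) \<longrightarrow>
            BKR_family d r A \<in> sets P \<and>
            measure P (BKR_family d r A) \<le> (\<Prod>i\<in>{1..r}. measure P (A i)))"
proof (intro conjI[of "\<forall>A\<in>_. _ A"] ballI allI impI)
  fix A B assume AB: "A \<in> borel_sets d" "B \<in> borel_sets d"
  have "{1..2} = {1, 2 :: nat}" by auto
  then show "BKR d A B \<in> sets P \<and> measure P (BKR d A B) \<le> measure P A * measure P B"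
    unfolding BKR_eq_BKR_family
    using BKR_family_measure_le[OF assms(2), of 2 "\<lambda>i. if i = 1 then A else B"] AB by simp
next
  fix r :: nat and A :: "nat \<Rightarrow> (nat \<Rightarrow> real) set"
  assume "2 \<le> r" "\<forall>i\<in>{1..r}. A i \<in> borel_sets d"
  then show "BKR_family d r A \<in> sets P \<and> measure P (BKR_family d r A) \<le> (\<Prod>i\<in>{1..r}. measure P (A i))"
    by (intro BKR_family_measure_le[OF assms(2)]) auto
qed

end
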